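(* Let $F$ be a non-archimedean local field of characteristic not $2$, with valuation ring $\mathfrak{o}$ and maximal ideal $\mathfrak{p}$, and let $H$ be a quaternion division algebra over $F$ with an orthogonal involution $\ddagger$. Then there is a unique maximal $\ddagger$-order of $H$, namely $$\mathcal{O}=\{h\in H : nrd(h)\in\mathfrak{o}\}.$$ The order $\mathcal{O}$ is also a maximal order, and $$disc(\mathcal{O})=\mathfrak{p}=disc(H)\cap\iota(disc(\ddagger)).$$
   Context: An involution on $H$ is an $F$-linear map $\ddagger$ with $(xy)^\ddagger=y^\ddagger x^\ddagger$, $\ddagger^2=\mathrm{id}$; it is orthogonal if $\{x: x^\ddagger=x\}$ has dimension $3$ (i.e. it is not quaternion conjugation). An order is an $\mathfrak{o}$-lattice in $H$ which is a subring containing $1$ spanning $H$. A $\ddagger$-order is an order $\mathcal{O}$ with $\mathcal{O}^\ddagger=\mathcal{O}$; a maximal $\ddagger$-order is one not properly contained in another $\ddagger$-order. $nrd$ is the reduced norm, $disc(\mathcal{O})$ the reduced discriminant of an order, and $disc(H)=\mathfrak{p}$ for a division algebra. $disc(\ddagger)=nrd(h)(F^\times)^2$ for any nonzero $h$ with $h^\ddagger=-h$. For a square class $[\lambda]$, $\iota([\lambda])$ is the ideal of $\mathfrak{o}$ generated by $[\lambda]\cap\mathfrak{o}$ (it equals $\mathfrak{o}$ if $ord_\mathfrak{p}(\lambda)$ is even and $\mathfrak{p}$ if odd). *)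

theory Defs
  imports "HOL-Analysis.Analysis"
begin

text \<open>The valuation v is only meaningful on nonzero elements.\<close>

definition oring :: "('a::field \<Rightarrow> int) \<Rightarrow> 'a set" where
  "oring v = {x. x = 0 \<or> v x \<ge> 0}"

definition pideal :: "('a::field \<Rightarrow> int) \<Rightarrow> 'a set" where
  "pideal v = {x. x = 0 \<or> v x \<ge> 1}"

definition val_cauchy :: "('a::field \<Rightarrow> int) \<Rightarrow> (nat \<Rightarrow> 'a) \<Rightarrow> bool" where
  "val_cauchy v s \<longleftrightarrow> (\<forall>N::int. \<exists>M. \<forall>m\<ge>M. \<forall>n\<ge>M. s m - s n = 0 \<or> v (s m - s n) \<ge> N)"

definition val_converges :: "('a::field \<Rightarrow> int) \<Rightarrow> (nat \<Rightarrow> 'a) \<Rightarrow> 'a \<Rightarrow> bool" where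
  "val_converges v s L \<longleftrightarrow> (\<forall>N::int. \<exists>M. \<forall>n\<ge>M. s n - L = 0 \<or> v (s n - L) \<ge> N)"

definition nonarch_local_field :: "('a::field \<Rightarrow> int) \<Rightarrow> bool" where
  "nonarch_local_field v \<longleftrightarrow>
     (\<forall>x y. x \<noteq> 0 \<longrightarrow> y \<noteq> 0 \<longrightarrow> v (x * y) = v x + v y) \<and>
     (\<forall>x y. x \<noteq> 0 \<longrightarrow> y \<noteq> 0 \<longrightarrow> x + y \<noteq> 0 \<longrightarrow> v (x + y) \<ge> min (v x) (v y)) \<and>
     (\<exists>\<pi>. \<pi> \<noteq> 0 \<and> v \<pi> = 1) \<and>
     (\<forall>s. val_cauchy v s \<longrightarrow> (\<exists>L. val_converges v s L)) \<and>
     (\<exists>R. finite R \<and> R \<subseteq> oring v \<and> (\<forall>x\<in>oring v. \<exists>r\<in>R. x - r \<in> pideal v))"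

section \<open>Quaternion algebras (a,b)_F, concretely on F^4 with basis 1,i,j,k=ij\<close>

datatype 'a quat = Q 'a 'a 'a 'a

fun qadd :: "'a::field quat \<Rightarrow> 'a quat \<Rightarrow> 'a quat" where
  "qadd (Q x0 x1 x2 x3) (Q y0 y1 y2 y3) = Q (x0+y0) (x1+y1) (x2+y2) (x3+y3)"

fun qscale :: "'a::field \<Rightarrow> 'a quat \<Rightarrow> 'a quat" where
  "qscale c (Q x0 x1 x2 x3) = Q (c*x0) (c*x1) (c*x2) (c*x3)"

definition qzero :: "'a::field quat" where "qzero = Q 0 0 0 0"
definition qone :: "'a::field quat" where "qone = Q 1 0 0 0"

fun qneg :: "'a::field quat \<Rightarrow> 'a quat" where
  "qneg (Q x0 x1 x2 x3) = Q (-x0) (-x1) (-x2) (-x3)"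

text \<open>Multiplication in (a,b)_F: i^2 = a, j^2 = b, k = ij = -ji.\<close>
fun qmul :: "'a::field \<Rightarrow> 'a \<Rightarrow> 'a quat \<Rightarrow> 'a quat \<Rightarrow> 'a quat" where
  "qmul a b (Q x0 x1 x2 x3) (Q y0 y1 y2 y3) =
     Q (x0*y0 + a*x1*y1 + b*x2*y2 - a*b*x3*y3)
       (x0*y1 + x1*y0 - b*x2*y3 + b*x3*y2)
       (x0*y2 + x2*y0 + a*x1*y3 - a*x3*y1)
       (x0*y3 + x3*y0 + x1*y2 - x2*y1)"

fun nrd :: "'a::field \<Rightarrow> 'a \<Rightarrow> 'a quat \<Rightarrow> 'a" where
  "nrd a b (Q x0 x1 x2 x3) = x0^2 - a*x1^2 - b*x2^2 + a*b*x3^2"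

fun trd :: "'a::field quat \<Rightarrow> 'a" where
  "trd (Q x0 x1 x2 x3) = 2 * x0"

definition lincomb :: "'a::field list \<Rightarrow> 'a quat list \<Rightarrow> 'a quat" where
  "lincomb cs gs = foldr qadd (map2 qscale cs gs) qzero"

definition quat_division :: "'a::field \<Rightarrow> 'a \<Rightarrow> bool" where
  "quat_division a b \<longleftrightarrow> a \<noteq> 0 \<and> b \<noteq> 0 \<and>
     (\<forall>x. x \<noteq> qzero \<longrightarrow> (\<exists>y. qmul a b x y = qone \<and> qmul a b y x = qone))"

definition involution :: "'a::field \<Rightarrow> 'a \<Rightarrow> ('a quat \<Rightarrow> 'a quat) \<Rightarrow> bool" where
  "involution a b \<sigma> \<longleftrightarrow>
     (\<forall>x y. \<sigma> (qadd x y) = qadd (\<sigma> x) (\<sigma> y)) \<and>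
     (\<forall>c x. \<sigma> (qscale c x) = qscale c (\<sigma> x)) \<and>
     (\<forall>x y. \<sigma> (qmul a b x y) = qmul a b (\<sigma> y) (\<sigma> x)) \<and>
     (\<forall>x. \<sigma> (\<sigma> x) = x)"

definition orth_involution :: "'a::field \<Rightarrow> 'a \<Rightarrow> ('a quat \<Rightarrow> 'a quat) \<Rightarrow> bool" where
  "orth_involution a b \<sigma> \<longleftrightarrow> involution a b \<sigma> \<and>
     (\<exists>u1 u2 u3. \<sigma> u1 = u1 \<and> \<sigma> u2 = u2 \<and> \<sigma> u3 = u3 \<and>
        (\<forall>c1 c2 c3. lincomb [c1,c2,c3] [u1,u2,u3] = qzero \<longrightarrow> c1 = 0 \<and> c2 = 0 \<and> c3 = 0) \<and>
        (\<forall>x. \<sigma> x = x \<longrightarrow> (\<exists>c1 c2 c3. x = lincomb [c1,c2,c3] [u1,u2,u3])))"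

definition o_lattice :: "('a::field \<Rightarrow> int) \<Rightarrow> 'a quat set \<Rightarrow> bool" where
  "o_lattice v L \<longleftrightarrow> (\<exists>gs.
      L = {lincomb cs gs | cs. length cs = length gs \<and> set cs \<subseteq> oring v} \<and>
      (\<forall>h. \<exists>ds. length ds = length gs \<and> h = lincomb ds gs))"

definition is_order :: "('a::field \<Rightarrow> int) \<Rightarrow> 'a \<Rightarrow> 'a \<Rightarrow> 'a quat set \<Rightarrow> bool" where
  "is_order v a b Ord \<longleftrightarrow> o_lattice v Ord \<and> qone \<in> Ord \<and> (\<forall>x\<in>Ord. \<forall>y\<in>Ord. qmul a b x y \<in> Ord)"

definition max_order :: "('a::field \<Rightarrow> int) \<Rightarrow> 'a \<Rightarrow> 'a \<Rightarrow> 'a quat set \<Rightarrow> bool" where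
  "max_order v a b Ord \<longleftrightarrow> is_order v a b Ord \<and> (\<forall>Ord'. is_order v a b Ord' \<longrightarrow> Ord \<subseteq> Ord' \<longrightarrow> Ord' = Ord)"

definition inv_order :: "('a::field \<Rightarrow> int) \<Rightarrow> 'a \<Rightarrow> 'a \<Rightarrow> ('a quat \<Rightarrow> 'a quat) \<Rightarrow> 'a quat set \<Rightarrow> bool" where
  "inv_order v a b \<sigma> Ord \<longleftrightarrow> is_order v a b Ord \<and> \<sigma> ` Ord = Ord"

definition max_inv_order :: "('a::field \<Rightarrow> int) \<Rightarrow> 'a \<Rightarrow> 'a \<Rightarrow> ('a quat \<Rightarrow> 'a quat) \<Rightarrow> 'a quat set \<Rightarrow> bool" where
  "max_inv_order v a b \<sigma> Ord \<longleftrightarrow> inv_order v a b \<sigma> Ord \<and>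
     (\<forall>Ord'. inv_order v a b \<sigma> Ord' \<longrightarrow> Ord \<subseteq> Ord' \<longrightarrow> Ord' = Ord)"

definition o_ideal_gen :: "('a::field \<Rightarrow> int) \<Rightarrow> 'a set \<Rightarrow> 'a set" where
  "o_ideal_gen v S = {sum_list (map2 (*) cs ss) | cs ss.
      length cs = length ss \<and> set cs \<subseteq> oring v \<and> set ss \<subseteq> S}"

definition o_ideal :: "('a::field \<Rightarrow> int) \<Rightarrow> 'a set \<Rightarrow> bool" where
  "o_ideal v I \<longleftrightarrow> I \<subseteq> oring v \<and> 0 \<in> I \<and> (\<forall>x\<in>I. \<forall>y\<in>I. x + y \<in> I) \<and>
     (\<forall>c\<in>oring v. \<forall>x\<in>I. c * x \<in> I)"

definition ideal_prod :: "('a::field \<Rightarrow> int) \<Rightarrow> 'a set \<Rightarrow> 'a set \<Rightarrow> 'a set" where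
  "ideal_prod v I J = o_ideal_gen v {x * y | x y. x \<in> I \<and> y \<in> J}"

definition order_disc_full :: "('a::field \<Rightarrow> int) \<Rightarrow> 'a \<Rightarrow> 'a \<Rightarrow> 'a quat set \<Rightarrow> 'a set" where
  "order_disc_full v a b Ord = o_ideal_gen v
     {det (\<chi> i j. trd (qmul a b (x i) (x j)) :: 'a^4^4) | x :: 4 \<Rightarrow> 'a quat. \<forall>i. x i \<in> Ord}"

definition order_disc :: "('a::field \<Rightarrow> int) \<Rightarrow> 'a \<Rightarrow> 'a \<Rightarrow> 'a quat set \<Rightarrow> 'a set" where
  "order_disc v a b Ord = (THE I. o_ideal v I \<and> ideal_prod v I I = order_disc_full v a b Ord)"

definition quat_disc :: "('a::field \<Rightarrow> int) \<Rightarrow> 'a \<Rightarrow> 'a \<Rightarrow> 'a set" where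
  "quat_disc v a b = (if quat_division a b then pideal v else oring v)"

text \<open>iota(disc(sigma)): disc(sigma) is the square class of nrd(h) for nonzero skew h;
  iota of a square class is o if the valuation is even, p if odd.\<close>
definition iota_disc_inv :: "('a::field \<Rightarrow> int) \<Rightarrow> 'a \<Rightarrow> 'a \<Rightarrow> ('a quat \<Rightarrow> 'a quat) \<Rightarrow> 'a set" where
  "iota_disc_inv v a b \<sigma> =
     (let h = (SOME h. h \<noteq> qzero \<and> \<sigma> h = qneg h) in
      if even (v (nrd a b h)) then oring v else pideal v)"

end

theory Submission
  imports Defs
begin

text \<open>
  By Hensel's lemma an element of integral norm has integral trace, so \<open>v \<circ> nrd\<close> is a valuation on
  the division algebra and its valuation ring \<open>W 0\<close> is closed under addition. Every order lies in
  \<open>W 0\<close>, because the powers of an element of a lattice ring have bounded denominators; so it only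
  remains to see that \<open>W 0\<close> is a lattice, and to compute its discriminant.

  There is an integral \<open>u\<close> whose residue generates a quadratic extension of the residue field:
  otherwise \<open>W 0\<close> would be commutative modulo every power of the uniformizer. A nonzero commutator
  \<open>z = h u - u h\<close> is orthogonal to \<open>F(u)\<close>, and its norm has odd valuation because every unit is a
  norm from the unramified extension \<open>F(u)\<close>. After scaling, \<open>nrd z\<close> is a uniformizer, and the parities
  of the valuations show that \<open>1, u, z, u z\<close> is an integral basis of \<open>W 0\<close>. With \<open>D = tr(u)\<^sup>2 - 4 nrd(u)\<close>,
  a unit, its Gram determinant for the trace form is \<open>- (nrd z)\<^sup>2 D\<^sup>2\<close>, of valuation 2.
\<close>

section \<open>Discretely valued local fields\<close>

text \<open>With one preimage \<open>s y\<close> chosen for each value, every element of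
  \<open>K\<close> is \<open>s y\<close> or \<open>\<nu> (s y)\<close>. The value at the fixed point
  \<open>k0\<close> accounts for a single element, which makes the inequality strict, as the later
  pigeonhole argument requires.\<close>

lemma card_image_two_to_one:
  assumes fin: "finite K" and k0: "k0 \<in> K" "\<nu> k0 = k0"
    and h: "\<And>k l. k \<in> K \<Longrightarrow> l \<in> K \<Longrightarrow> h k = h l \<Longrightarrow> l = k \<or> l = \<nu> k"
  shows "card K < 2 * card (h ` K)"
proof -
  define s where "s y = (if y = h k0 then k0 else inv_into K h y)" for y
  let ?A = "h ` K"
  have s: "s (h k) \<in> K" "h (s (h k)) = h k" if "k \<in> K" for k
    using that k0 by (auto simp: s_def inv_into_into f_inv_into_f)
  have "K \<subseteq> s ` ?A \<union> (\<nu> \<circ> s) ` (?A - {h k0})"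
  proof
    fix k assume k: "k \<in> K"
    then have "k = s (h k) \<or> k = \<nu> (s (h k))" using h[OF s(1)[OF k] k s(2)[OF k]] by simp
    moreover have "k = s (h k)" if "h k = h k0" using that h[OF k0(1) k] k0 by (auto simp: s_def)
    ultimately show "k \<in> s ` ?A \<union> (\<nu> \<circ> s) ` (?A - {h k0})" using k by fastforce
  qed
  then have "card K \<le> card (s ` ?A \<union> (\<nu> \<circ> s) ` (?A - {h k0}))"
    using fin by (intro card_mono) auto
  also have "\<dots> \<le> card (s ` ?A) + card ((\<nu> \<circ> s) ` (?A - {h k0}))" by (rule card_Un_le)
  also have "\<dots> \<le> card ?A + card (?A - {h k0})"
    using fin by (intro add_mono card_image_le) auto
  also have "\<dots> < 2 * card ?A"
    using fin k0(1) card_gt_0_iff[of ?A] by (simp add: card_Diff_singleton) auto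
  finally show ?thesis .
qed

text \<open>The fractional ideal p^N for any integer N; zero is listed separately because
  \<open>v 0\<close> carries no meaning.\<close>

definition pideal_pow :: "('a::field \<Rightarrow> int) \<Rightarrow> int \<Rightarrow> 'a set" where
  "pideal_pow v N = {x. x = 0 \<or> N \<le> v x}"

locale local_field =
  fixes v :: "'a::field \<Rightarrow> int"
  assumes nonarch: "nonarch_local_field v"
begin

abbreviation P :: "int \<Rightarrow> 'a set" where "P \<equiv> pideal_pow v"

lemma P_iff: "x \<in> P N \<longleftrightarrow> x = 0 \<or> N \<le> v x"
  by (simp add: pideal_pow_def)

lemma oring_eq: "oring v = P 0" and pideal_eq: "pideal v = P 1"
  by (auto simp: oring_def pideal_def pideal_pow_def)

lemma v_mult: "x \<noteq> 0 \<Longrightarrow> y \<noteq> 0 \<Longrightarrow> v (x * y) = v x + v y"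
  and v_add: "x \<noteq> 0 \<Longrightarrow> y \<noteq> 0 \<Longrightarrow> x + y \<noteq> 0 \<Longrightarrow> min (v x) (v y) \<le> v (x + y)"
  and uniformizer_ex: "\<exists>\<pi>. \<pi> \<noteq> 0 \<and> v \<pi> = 1"
  and complete: "val_cauchy v s \<Longrightarrow> \<exists>L. val_converges v s L"
  and residue_finite: "\<exists>R. finite R \<and> R \<subseteq> oring v \<and> (\<forall>x\<in>oring v. \<exists>r\<in>R. x - r \<in> pideal v)"
  using nonarch unfolding nonarch_local_field_def by blast+

lemma v_one [simp]: "v 1 = 0"
  using v_mult[of 1 1] by simp

lemma v_minus [simp]: "v (- x) = v x"
proof (cases "x = 0")
  case False
  have "v (-1) = 0" using v_mult[of "-1" "-1"] by simp
  then show ?thesis using v_mult[of "-1" x] False by simp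
qed simp

lemma v_inverse: "x \<noteq> 0 \<Longrightarrow> v (inverse x) = - v x"
  using v_mult[of x "inverse x"] by simp

lemma v_divide: "x \<noteq> 0 \<Longrightarrow> y \<noteq> 0 \<Longrightarrow> v (x / y) = v x - v y"
  by (simp add: divide_inverse v_mult v_inverse)

lemma v_power: "x \<noteq> 0 \<Longrightarrow> v (x ^ n) = int n * v x"
  by (induction n) (auto simp: v_mult algebra_simps)

lemma P_zero [simp]: "0 \<in> P N"
  by (simp add: P_iff)

lemma P_one [simp]: "1 \<in> P 0"
  by (simp add: P_iff)

lemma one_notin_P1 [simp]: "1 \<notin> P 1"
  by (simp add: P_iff)

lemma P_mono: "x \<in> P M \<Longrightarrow> N \<le> M \<Longrightarrow> x \<in> P N"
  by (auto simp: P_iff)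

lemma P_add: "x \<in> P N \<Longrightarrow> y \<in> P N \<Longrightarrow> x + y \<in> P N"
  using v_add[of x y] by (cases "x = 0"; cases "y = 0"; cases "x + y = 0") (auto simp: P_iff)

lemma P_minus: "x \<in> P N \<Longrightarrow> - x \<in> P N"
  by (auto simp: P_iff)

lemma P_diff: "x \<in> P N \<Longrightarrow> y \<in> P N \<Longrightarrow> x - y \<in> P N"
  using P_add[of x N "- y"] P_minus by simp

lemma P_mult: "x \<in> P M \<Longrightarrow> y \<in> P N \<Longrightarrow> x * y \<in> P (M + N)"
  using v_mult[of x y] by (cases "x = 0"; cases "y = 0") (auto simp: P_iff)

lemma P_mult0 [intro]: "x \<in> P 0 \<Longrightarrow> y \<in> P N \<Longrightarrow> x * y \<in> P N"
  and P_mult0' [intro]: "x \<in> P N \<Longrightarrow> y \<in> P 0 \<Longrightarrow> x * y \<in> P N"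
  using P_mult[of x 0 y N] P_mult[of x N y 0] by simp_all

lemma P_sq: "x \<in> P M \<Longrightarrow> x\<^sup>2 \<in> P (2 * M)"
  using P_mult[of x M x M] by (simp add: power2_eq_square)

lemma P_divide: "x \<in> P M \<Longrightarrow> y \<noteq> 0 \<Longrightarrow> v y \<le> K \<Longrightarrow> N \<le> M - K \<Longrightarrow> x / y \<in> P N"
  using v_divide[of x y] by (cases "x = 0") (auto simp: P_iff)

lemma P_numeral: "numeral k \<in> P 0"
proof -
  have "of_nat n \<in> P 0" for n by (induction n) (auto intro: P_add)
  from this[of "numeral k"] show ?thesis by simp
qed

lemma unit_iff: "x \<in> P 0 \<Longrightarrow> x \<notin> P 1 \<longleftrightarrow> x \<noteq> 0 \<and> v x = 0"
  by (auto simp: P_iff)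

lemma unit_mult: "x \<in> P 0 \<Longrightarrow> x \<notin> P 1 \<Longrightarrow> y \<in> P 0 \<Longrightarrow> y \<notin> P 1 \<Longrightarrow> x * y \<in> P 0 \<and> x * y \<notin> P 1"
  using v_mult[of x y] by (auto simp: P_iff)

lemma unit_divide: "x \<in> P N \<Longrightarrow> y \<in> P 0 \<Longrightarrow> y \<notin> P 1 \<Longrightarrow> x / y \<in> P N"
  by (rule P_divide[of _ N _ 0]) (auto simp: P_iff)

lemma P_eq_zero: "(\<And>n::nat. x \<in> P (int n)) \<Longrightarrow> x = 0"
proof (rule ccontr)
  assume *: "\<And>n::nat. x \<in> P (int n)" and "x \<noteq> 0"
  with *[of "nat (v x + 1)"] show False by (auto simp: P_iff split: if_splits)
qed

text \<open>Summands of different valuations cannot cancel: the sum has the smaller of the two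
  valuations.\<close>

lemma P_addD: 
  assumes "x + y \<in> P N" "x = 0 \<or> y = 0 \<or> v x \<noteq> v y"
  shows "x \<in> P N"
proof (rule ccontr)
  assume x: "x \<notin> P N"
  then have x': "x \<noteq> 0" "v x < N" by (auto simp: P_iff)
  have s: "x + y \<in> P (v x + 1)" using assms(1) x' by (auto intro: P_mono)
  consider "y = 0" | "y \<noteq> 0" "v x < v y" | "y \<noteq> 0" "v y < v x" using assms x' by fastforce
  then show False
  proof cases
    case 1 then show ?thesis using assms x by simp
  next
    case 2
    then have "(x + y) - y \<in> P (v x + 1)" using s by (intro P_diff) (auto simp: P_iff)
    then show ?thesis using x' by (simp add: P_iff)
  next
    case 3
    then have "(x + y) - x \<in> P (v y + 1)" using s by (intro P_diff P_mono[OF s]) (auto simp: P_iff)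
    then show ?thesis using 3 by (simp add: P_iff)
  qed
qed

definition \<pi> :: 'a where "\<pi> = (SOME \<pi>. \<pi> \<noteq> 0 \<and> v \<pi> = 1)"

lemma pi_nz [simp]: "\<pi> \<noteq> 0" and v_pi [simp]: "v \<pi> = 1"
  using someI_ex[OF uniformizer_ex] by (auto simp: \<pi>_def)

lemma ex_val: "\<exists>c. c \<noteq> 0 \<and> v c = k"
proof (cases "k \<ge> 0")
  case True
  then show ?thesis by (intro exI[of _ "\<pi> ^ nat k"]) (simp add: v_power)
next
  case False
  then show ?thesis by (intro exI[of _ "inverse (\<pi> ^ nat (-k))"]) (simp add: v_power v_inverse)
qed

text \<open>The fixed point is the limit of iterating the contraction \<open>s \<mapsto> c + d s\<^sup>2\<close> of the maximal ideal;
  it yields Hensel's lemma for quadratic polynomials.\<close>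

lemma contraction_fixpoint:
  assumes c: "c \<in> P 1" and d: "d \<in> P 0"
  shows "\<exists>s \<in> P 1. s = c + d * s\<^sup>2"
proof -
  define s where "s = rec_nat 0 (\<lambda>_ x. c + d * x\<^sup>2)"
  have s0: "s 0 = 0" and sS: "\<And>n. s (Suc n) = c + d * (s n)\<^sup>2" by (simp_all add: s_def)
  have sP: "s n \<in> P 1" for n
  proof (induction n)
    case (Suc n)
    then have "(s n)\<^sup>2 \<in> P 1" using P_sq P_mono by fastforce
    then show ?case unfolding sS using c d by (intro P_add P_mult0)
  qed (simp add: s0)
  \<comment> \<open>The factor \<open>x + y\<close> of \<open>x\<^sup>2 - y\<^sup>2\<close> lies in
    p, so each iteration gains a power of p.\<close>
  have step: "d * (x\<^sup>2 - y\<^sup>2) \<in> P (N + 1)" if "x \<in> P 1" "y \<in> P 1" "x - y \<in> P N" for x y N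
  proof -
    have "d * ((x - y) * (x + y)) \<in> P (N + 1)"
      using that d by (intro P_mult0 P_mult P_add)
    then show ?thesis by (simp add: algebra_simps power2_eq_square)
  qed
  have diff: "s (m + k) - s m \<in> P (int m + 1)" for m k
  proof (induction m)
    case 0
    then show ?case using sP by (simp add: s0)
  next
    case (Suc m)
    have "s (Suc m + k) - s (Suc m) = d * ((s (m + k))\<^sup>2 - (s m)\<^sup>2)"
      by (simp add: sS algebra_simps)
    then show ?case using step[OF sP sP Suc] by (simp add: add.commute)
  qed
  have diff': "s m - s n \<in> P (int M + 1)" if "m \<ge> M" "n \<ge> M" for m n M
  proof -
    have "(s (M + (m - M)) - s M) - (s (M + (n - M)) - s M) \<in> P (int M + 1)"
      by (intro P_diff diff)
    then show ?thesis using that by simp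
  qed
  have "val_cauchy v s"
    unfolding val_cauchy_def
  proof
    fix N
    show "\<exists>M. \<forall>m\<ge>M. \<forall>n\<ge>M. s m - s n = 0 \<or> N \<le> v (s m - s n)"
    proof (intro exI[of _ "nat N"] allI impI)
      fix m n assume "m \<ge> nat N" "n \<ge> nat N"
      then have "s m - s n \<in> P (int (nat N) + 1)" by (rule diff')
      then show "s m - s n = 0 \<or> N \<le> v (s m - s n)" by (auto simp: P_iff split: if_splits)
    qed
  qed
  then obtain L where L: "val_converges v s L" using complete by blast
  have ev: "\<exists>M. \<forall>n\<ge>M. s n - L \<in> P N" for N
    using L unfolding val_converges_def P_iff by blast
  have LP: "L \<in> P 1"
  proof -
    obtain n where "s n - L \<in> P 1" using ev by blast
    then have "s n - (s n - L) \<in> P 1" by (rule P_diff[OF sP])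
    then show ?thesis by simp
  qed
  have "L - (c + d * L\<^sup>2) \<in> P (int N)" for N
  proof -
    obtain M where M: "\<And>n. n \<ge> M \<Longrightarrow> s n - L \<in> P (int N)" using ev by blast
    have 1: "s M - L \<in> P (int N)" "s (Suc M) - L \<in> P (int N)" using M[of M] M[of "Suc M"] by auto
    have "d * ((s M)\<^sup>2 - L\<^sup>2) - (s (Suc M) - L) \<in> P (int N)"
      by (intro P_diff[OF _ 1(2)] P_mono[OF step[OF sP LP 1(1)]]) simp
    then show ?thesis by (simp add: sS algebra_simps)
  qed
  then have "L - (c + d * L\<^sup>2) = 0" by (rule P_eq_zero)
  then show ?thesis using LP by auto
qed

text \<open>Division by the unit \<open>T\<close>, the derivative at 0, gives the fixed-point
  equation of a contraction.\<close>

lemma hensel_quadratic: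
  assumes "e \<in> P 1" "n \<in> P 0" "T \<in> P 0" "T \<notin> P 1"
  shows "\<exists>s \<in> P 1. n * s\<^sup>2 + T * s + e = 0"
proof -
  have T: "T \<noteq> 0" using assms by auto
  obtain s where s: "s \<in> P 1" "s = - (e / T) + - (n / T) * s\<^sup>2"
    using contraction_fixpoint[OF P_minus[OF unit_divide[OF assms(1,3,4)]] P_minus[OF unit_divide[OF assms(2-4)]]]
    by blast
  have "T * s = T * (- (e / T) + - (n / T) * s\<^sup>2)" using s(2) by simp
  also have "\<dots> = - e - n * s\<^sup>2" using T by (simp add: algebra_simps)
  finally show ?thesis using s(1) by (intro bexI[of _ s]) auto
qed

text \<open>Representatives of the residue field with their reduction map: counting over the residue
  field then takes place in a finite subset of o.\<close>

definition residue_system :: "'a set \<Rightarrow> ('a \<Rightarrow> 'a) \<Rightarrow> bool" where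
  "residue_system K \<rho> \<longleftrightarrow> finite K \<and> K \<subseteq> P 0 \<and> (\<forall>x \<in> P 0. \<rho> x \<in> K \<and> x - \<rho> x \<in> P 1) \<and>
     (\<forall>x y. x - y \<in> P 1 \<longrightarrow> \<rho> x = \<rho> y) \<and> (\<forall>k \<in> K. \<rho> k = k)"

lemma residue_systemD:
  assumes "residue_system K \<rho>"
  shows "finite K" "K \<subseteq> P 0" "x \<in> P 0 \<Longrightarrow> \<rho> x \<in> K" "x \<in> P 0 \<Longrightarrow> x - \<rho> x \<in> P 1"
    "x - y \<in> P 1 \<Longrightarrow> \<rho> x = \<rho> y" "k \<in> K \<Longrightarrow> \<rho> k = k"
  using assms unfolding residue_system_def by blast+

lemma residue_system_ex: "\<exists>K \<rho>. residue_system K \<rho>"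
proof -
  obtain R where R: "finite R" "R \<subseteq> P 0" "\<And>x. x \<in> P 0 \<Longrightarrow> \<exists>r\<in>R. x - r \<in> P 1"
    using residue_finite unfolding oring_eq pideal_eq by blast
  define \<rho> where "\<rho> x = (SOME r. r \<in> R \<and> x - r \<in> P 1)" for x
  have \<rho>: "\<rho> x \<in> R" "x - \<rho> x \<in> P 1" if "x \<in> P 0" for x
    using someI_ex[of "\<lambda>r. r \<in> R \<and> x - r \<in> P 1"] R(3)[OF that] unfolding \<rho>_def by blast+
  have eq: "\<rho> x = \<rho> y" if "x - y \<in> P 1" for x y
  proof -
    have "x - r \<in> P 1 \<longleftrightarrow> y - r \<in> P 1" for r
      using P_diff[OF _ that, of "x - r"] P_add[OF _ that, of "y - r"] by (auto simp: algebra_simps)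
    then show ?thesis by (simp add: \<rho>_def)
  qed
  have "residue_system (\<rho> ` P 0) \<rho>"
    unfolding residue_system_def
  proof (intro conjI ballI allI impI)
    have "\<rho> ` P 0 \<subseteq> R" using \<rho>(1) by auto
    then show "finite (\<rho> ` P 0)" "\<rho> ` P 0 \<subseteq> P 0" using R(1,2) finite_subset by auto
    show "\<rho> k = k" if "k \<in> \<rho> ` P 0" for k
    proof -
      obtain x where x: "x \<in> P 0" "k = \<rho> x" using \<open>k \<in> \<rho> ` P 0\<close> by blast
      show ?thesis using eq[OF \<rho>(2)[OF x(1)]] x(2) by simp
    qed
    show "x - \<rho> x \<in> P 1" if "x \<in> P 0" for x using \<rho>(2)[OF that] .
    show "\<rho> x = \<rho> y" if "x - y \<in> P 1" for x y using eq[OF that] .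
  qed (rule imageI)
  then show ?thesis by blast
qed

lemma P1_sqD: "x\<^sup>2 \<in> P 1 \<Longrightarrow> x \<in> P 1"
  using v_power[of x 2] by (cases "x = 0") (auto simp: P_iff)

text \<open>In residue characteristic 2 squaring is the Frobenius map, injective on a finite field
  and hence surjective.\<close>

lemma residue_char2_square:
  assumes 2: "2 \<in> P 1" and c: "c \<in> P 0"
  shows "\<exists>r \<in> P 0. r\<^sup>2 - c \<in> P 1"
proof -
  obtain K \<rho> where "residue_system K \<rho>" using residue_system_ex by blast
  note K = residue_systemD[OF this]
  have sqP: "k\<^sup>2 \<in> P 0" if "k \<in> K" for k using that K(2) P_sq[of k 0] by auto
  have inj: "inj_on (\<lambda>k. \<rho> (k\<^sup>2)) K"
  proof (rule inj_onI)
    fix k l assume kl: "k \<in> K" "l \<in> K" "\<rho> (k\<^sup>2) = \<rho> (l\<^sup>2)"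
    \<comment> \<open>This rests on
      \<open>(k - l)\<^sup>2 = k\<^sup>2 - l\<^sup>2 - 2 * (l * (k - l))\<close>.\<close>
    have "(k\<^sup>2 - \<rho> (k\<^sup>2)) - (l\<^sup>2 - \<rho> (l\<^sup>2)) - 2 * (l * (k - l)) \<in> P 1"
      using kl K(2) by (intro P_diff K(4) sqP P_mult0'[OF 2] P_mult0) auto
    then have "(k - l)\<^sup>2 \<in> P 1"
      using kl by (simp add: algebra_simps power2_eq_square)
    then have "\<rho> k = \<rho> l" by (rule K(5)[OF P1_sqD])
    then show "k = l" using kl K(6) by simp
  qed
  have "(\<lambda>k. \<rho> (k\<^sup>2)) ` K = K"
    using endo_inj_surj[OF K(1) _ inj] K(3) sqP by blast
  then have "\<rho> c \<in> (\<lambda>k. \<rho> (k\<^sup>2)) ` K" using K(3)[OF c] by simp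
  then obtain k where k: "k \<in> K" "\<rho> (k\<^sup>2) = \<rho> c" by (elim imageE) simp
  have "(k\<^sup>2 - \<rho> (k\<^sup>2)) - (c - \<rho> c) \<in> P 1"
    using k c by (intro P_diff K(4) sqP)
  then show ?thesis using k K(2) by (intro bexI[of _ k]) auto
qed

text \<open>The squares and the values \<open>c + d * y\<^sup>2\<close> each fill more than half of
  the residue classes, so the two sets meet.\<close>

lemma residue_odd_binary:
  assumes 2: "2 \<notin> P 1" and d: "d \<in> P 0" "d \<notin> P 1" and c: "c \<in> P 0"
  shows "\<exists>x \<in> P 0. \<exists>y \<in> P 0. x\<^sup>2 - d * y\<^sup>2 - c \<in> P 1"
proof -
  obtain K \<rho> where "residue_system K \<rho>" using residue_system_ex by blast
  note K = residue_systemD[OF this]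
  have sqP: "k\<^sup>2 \<in> P 0" if "k \<in> K" for k using that K(2) P_sq[of k 0] by auto
  have cong: "x - y \<in> P 1" if "\<rho> x = \<rho> y" "x \<in> P 0" "y \<in> P 0" for x y
    using P_diff[OF K(4)[OF that(2)] K(4)[OF that(3)]] that(1) by simp
  define \<nu> where "\<nu> k = \<rho> (- k)" for k
  have sq: "l = k \<or> l = \<nu> k" if "k \<in> K" "l \<in> K" "k\<^sup>2 - l\<^sup>2 \<in> P 1" for k l
  proof -
    have "(k - l) * (k + l) \<in> P 1" using that(3) by (simp add: algebra_simps power2_eq_square)
    moreover have "k - l \<in> P 0" "k + l \<in> P 0" using that K(2) by (auto intro: P_diff P_add)
    ultimately have "k - l \<in> P 1 \<or> k + l \<in> P 1" using unit_mult by blast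
    then show ?thesis
    proof
      assume "k - l \<in> P 1" then show ?thesis using K(5)[of k l] K(6) that by auto
    next
      assume "k + l \<in> P 1"
      then have "\<rho> l = \<rho> (- k)" by (intro K(5)) (simp add: algebra_simps)
      then show ?thesis using K(6) that by (simp add: \<nu>_def)
    qed
  qed
  define k0 where "k0 = \<rho> 0"
  have k0: "k0 \<in> K" by (simp add: k0_def K(3))
  have "k0 \<in> P 1" using P_minus[OF K(4)[of 0]] by (simp add: k0_def)
  then have k0': "\<nu> k0 = k0" unfolding \<nu>_def using K(5)[of "-k0" 0] P_minus by (simp add: k0_def)
  define f where "f k = \<rho> (k\<^sup>2)" for k
  define g where "g k = \<rho> (c + d * k\<^sup>2)" for k
  have gP: "c + d * k\<^sup>2 \<in> P 0" if "k \<in> K" for k using that sqP c d by (intro P_add P_mult0)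
  have f: "card K < 2 * card (f ` K)"
  proof (rule card_image_two_to_one[where \<nu> = \<nu>, OF K(1) k0 k0'])
    fix k l assume "k \<in> K" "l \<in> K" "f k = f l"
    then show "l = k \<or> l = \<nu> k" unfolding f_def by (intro sq cong sqP)
  qed
  have g: "card K < 2 * card (g ` K)"
  proof (rule card_image_two_to_one[where \<nu> = \<nu>, OF K(1) k0 k0'])
    fix k l assume kl: "k \<in> K" "l \<in> K" "g k = g l"
    then have "(c + d * k\<^sup>2) - (c + d * l\<^sup>2) \<in> P 1" unfolding g_def by (intro cong gP)
    then have "d * (k\<^sup>2 - l\<^sup>2) \<in> P 1" by (simp add: algebra_simps)
    moreover have "k\<^sup>2 - l\<^sup>2 \<in> P 0" using kl by (intro P_diff sqP)
    ultimately have "k\<^sup>2 - l\<^sup>2 \<in> P 1" using unit_mult d by blast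
    then show "l = k \<or> l = \<nu> k" using kl by (intro sq)
  qed
  have sub: "f ` K \<subseteq> K" "g ` K \<subseteq> K" using K(3) sqP gP by (auto simp: f_def g_def)
  have "f ` K \<inter> g ` K \<noteq> {}"
  proof
    assume "f ` K \<inter> g ` K = {}"
    then have "card (f ` K) + card (g ` K) = card (f ` K \<union> g ` K)"
      using K(1) by (simp add: card_Un_disjoint)
    also have "\<dots> \<le> card K" using K(1) sub by (intro card_mono) auto
    finally show False using f g by simp
  qed
  then obtain x y where xy: "x \<in> K" "y \<in> K" "f x = g y" by auto
  then have "x\<^sup>2 - (c + d * y\<^sup>2) \<in> P 1" unfolding f_def g_def by (intro cong sqP gP)
  then show ?thesis using xy K(2) by (intro bexI[of _ x] bexI[of _ y]) (auto simp: algebra_simps)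
qed

text \<open>This is the norm form of o[X]/(X^2 - tX + n), whose discriminant is a unit. A solution
  modulo p comes from the counting lemmas and is lifted by Hensel in a variable whose partial
  derivative is a unit.\<close>

lemma unramified_norm_represents_unit:
  assumes t: "t \<in> P 0" and n: "n \<in> P 0" and D: "t\<^sup>2 - 4 * n \<notin> P 1"
    and c: "c \<in> P 0" "c \<notin> P 1"
  shows "\<exists>r s. r\<^sup>2 + t * r * s + n * s\<^sup>2 = c"
proof (cases "2 \<in> P 1")
  case 2: True
  have t1: "t \<notin> P 1"
  proof
    assume "t \<in> P 1"
    then have "t * t - 2 * (2 * n) \<in> P 1" using n t 2
      by (intro P_diff P_mult0 P_mult0'[OF 2]) (auto intro: P_numeral)
    then show False using D by (simp add: power2_eq_square)
  qed
  obtain r where r: "r \<in> P 0" "r\<^sup>2 - c \<in> P 1" using residue_char2_square[OF 2 c(1)] by blast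
  have r1: "r \<notin> P 1"
  proof
    assume "r \<in> P 1"
    then have "r * r - (r\<^sup>2 - c) \<in> P 1" by (intro P_diff[OF _ r(2)] P_mult0 r(1))
    then show False using c by (simp add: power2_eq_square)
  qed
  obtain s where "n * s\<^sup>2 + (t * r) * s + (r\<^sup>2 - c) = 0"
    using hensel_quadratic[OF r(2) n] unit_mult[OF t t1 r(1) r1] by blast
  then show ?thesis by (intro exI[of _ r] exI[of _ s]) (simp add: algebra_simps)
next
  case 2: False
  have 20: "(2::'a) \<in> P 0" by (rule P_numeral)
  have 22: "(2::'a) \<noteq> 0" using 2 by auto
  have 4: "(4::'a) \<in> P 0" "(4::'a) \<notin> P 1" using unit_mult[OF 20 2 20 2] by auto
  define d where "d = (t\<^sup>2 - 4 * n) / 4"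
  have d: "d \<in> P 0"
    unfolding d_def using P_sq[OF t] t n by (intro unit_divide 4 P_diff P_mult0) auto
  have d4: "4 * d = t\<^sup>2 - 4 * n" using 4 by (auto simp: d_def)
  have d1: "d \<notin> P 1" using D d4 P_mult0[OF 4(1), of d 1] by auto
  obtain x y where xy: "x \<in> P 0" "y \<in> P 0" "x\<^sup>2 - d * y\<^sup>2 - c \<in> P 1"
    using residue_odd_binary[OF 2 d d1 c(1)] by blast
  \<comment> \<open>If \<open>x\<close> is a unit, it is lifted; otherwise \<open>y\<close> is a
    unit because \<open>c\<close> is, and \<open>y\<close> is lifted.\<close>
  have "\<exists>X Y. X\<^sup>2 - d * Y\<^sup>2 = c"
  proof (cases "x \<in> P 1")
    case False
    obtain s where "1 * s\<^sup>2 + (2 * x) * s + (x\<^sup>2 - d * y\<^sup>2 - c) = 0"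
      using hensel_quadratic[OF xy(3) P_one] unit_mult[OF 20 2 xy(1) False] by blast
    then show ?thesis by (intro exI[of _ "x + s"] exI[of _ y]) (simp add: algebra_simps power2_eq_square)
  next
    case True
    have y1: "y \<notin> P 1"
    proof
      assume "y \<in> P 1"
      then have "x * x - d * (y * y) - (x\<^sup>2 - d * y\<^sup>2 - c) \<in> P 1"
        by (intro P_diff[OF _ xy(3)] P_diff P_mult0 xy d True)
      then show False using c by (simp add: power2_eq_square)
    qed
    have dy: "2 * (d * y) \<in> P 0 \<and> 2 * (d * y) \<notin> P 1"
      using unit_mult[OF d d1 xy(2) y1] unit_mult[OF 20 2] by blast
    have "- (2 * (d * y)) \<in> P 0" "- (2 * (d * y)) \<notin> P 1" "-d \<in> P 0"
      using dy P_minus[of "- (2 * (d * y))" 1] d P_minus by auto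
    from hensel_quadratic[OF xy(3) this(3) this(1,2)]
    obtain s where "- d * s\<^sup>2 + (- (2 * (d * y))) * s + (x\<^sup>2 - d * y\<^sup>2 - c) = 0" by blast
    then show ?thesis by (intro exI[of _ x] exI[of _ "y + s"]) (simp add: algebra_simps power2_eq_square)
  qed
  then obtain X Y where XY: "X\<^sup>2 - d * Y\<^sup>2 = c" by blast
  \<comment> \<open>The completed square is undone by \<open>r = X - t * w\<close> and
    \<open>s = 2 * w\<close>.\<close>
  define w where "w = Y / 2"
  have Y: "Y = 2 * w" using 22 by (simp add: w_def)
  have "(X - t * w)\<^sup>2 + t * (X - t * w) * (2 * w) + n * (2 * w)\<^sup>2 = X\<^sup>2 - (t\<^sup>2 - 4 * n) * w\<^sup>2"
    by (simp add: algebra_simps power2_eq_square)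
  also have "\<dots> = X\<^sup>2 - d * Y\<^sup>2"
    unfolding d4[symmetric] Y by (simp add: algebra_simps power2_eq_square)
  finally show ?thesis using XY by blast
qed

end

section \<open>Integral elements of a quaternion division algebra\<close>

fun qconj :: "'a::field quat \<Rightarrow> 'a quat" where
  "qconj (Q x0 x1 x2 x3) = Q x0 (-x1) (-x2) (-x3)"

definition qcomm :: "'a::field \<Rightarrow> 'a \<Rightarrow> 'a quat \<Rightarrow> 'a quat \<Rightarrow> 'a quat" where
  "qcomm a b x y = qadd (qmul a b x y) (qneg (qmul a b y x))"

lemma nrd_qmul: "nrd a b (qmul a b x y) = nrd a b x * nrd a b y"
  by (cases x; cases y) (simp add: algebra_simps power2_eq_square)

lemma nrd_qscale: "nrd a b (qscale c x) = c\<^sup>2 * nrd a b x"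
  by (cases x) (simp add: algebra_simps power2_eq_square)

lemma nrd_qneg: "nrd a b (qneg x) = nrd a b x"
  by (cases x) simp

lemma nrd_qconj: "nrd a b (qconj x) = nrd a b x"
  by (cases x) simp

lemma nrd_qadd_scalar: "nrd a b (qadd x (Q r 0 0 0)) = r\<^sup>2 + trd x * r + nrd a b x"
  by (cases x) (simp add: algebra_simps power2_eq_square)

lemma nrd_qone [simp]: "nrd a b qone = 1" and nrd_qzero [simp]: "nrd a b qzero = 0"
  by (simp_all add: qone_def qzero_def)

lemma qmul_qone [simp]: "qmul a b x qone = x" "qmul a b qone x = x"
  by (cases x; simp add: qone_def)+

lemma qmul_assoc: "qmul a b (qmul a b x y) z = qmul a b x (qmul a b y z)"
  by (cases x; cases y; cases z) (simp add: algebra_simps)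

lemma qmul_qconj: "qmul a b x (qmul a b (qconj x) y) = qscale (nrd a b x) y"
  by (cases x; cases y) (simp add: algebra_simps power2_eq_square)

lemma qadd_commute: "qadd x y = qadd y x"
  by (cases x; cases y) simp

lemma qadd_assoc: "qadd (qadd x y) z = qadd x (qadd y z)"
  by (cases x; cases y; cases z) simp

lemma qadd_qzero [simp]: "qadd x qzero = x" "qadd qzero x = x"
  by (cases x; simp add: qzero_def)+

lemma qmul_qadd_right: "qmul a b x (qadd y z) = qadd (qmul a b x y) (qmul a b x z)"
  by (cases x; cases y; cases z) (simp add: algebra_simps)

lemma qmul_qscale: "qmul a b (qscale c x) y = qscale c (qmul a b x y)"
  "qmul a b x (qscale c y) = qscale c (qmul a b x y)"
  by (cases x; cases y; simp add: algebra_simps)+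

lemma qscale_qscale: "qscale c (qscale d x) = qscale (c * d) x"
  by (cases x) simp

lemma qscale_one [simp]: "qscale 1 x = x" and qscale_zero [simp]: "qscale 0 x = qzero"
  by (cases x; simp add: qzero_def)+

lemma trd_qadd: "trd (qadd x y) = trd x + trd y"
  by (cases x; cases y) (simp add: algebra_simps)

lemma trd_qscale: "trd (qscale c x) = c * trd x"
  by (cases x) simp

lemma trd_qmul_self: "trd (qmul a b x x) = (trd x)\<^sup>2 - 2 * nrd a b x"
  by (cases x) (simp add: algebra_simps power2_eq_square)

lemma trd_qmul_qmul: "trd (qmul a b x (qmul a b x y)) = trd x * trd (qmul a b x y) - nrd a b x * trd y"
  by (cases x; cases y) (simp add: algebra_simps power2_eq_square)

lemma trd_qmul_commute: "trd (qmul a b x y) = trd (qmul a b y x)"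
  by (cases x; cases y) (simp add: algebra_simps)

text \<open>Scalars are central and \<open>\<omega>\<close> commutes with itself, so a commutator of
  two such elements acquires a factor \<open>p\<close>. With \<open>p = \<pi>\<close> this drives
  the divisibility argument.\<close>

lemma qcomm_expand:
  "qcomm a b (qadd (qadd (Q r 0 0 0) (qscale r' \<omega>)) (qscale p x))
             (qadd (qadd (Q s 0 0 0) (qscale s' \<omega>)) (qscale p y)) =
   qscale p (qadd (qadd (qscale r' (qcomm a b \<omega> y)) (qscale s' (qcomm a b x \<omega>)))
                  (qscale p (qcomm a b x y)))"
  by (cases \<omega>; cases x; cases y) (simp add: qcomm_def algebra_simps)

section \<open>The filtration by the valuation of the norm\<close>

locale quaternion_division = local_field v
  for v :: "'a::field \<Rightarrow> int" +
  fixes a b :: 'a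
  assumes two: "(2::'a) \<noteq> 0" and division: "quat_division a b"
begin

abbreviation "qm \<equiv> qmul a b"
abbreviation "nr \<equiv> nrd a b"

lemma ab_nz: "a \<noteq> 0" "b \<noteq> 0"
  using division by (auto simp: quat_division_def)

lemma nr_zero_iff [simp]: "nr x = 0 \<longleftrightarrow> x = qzero"
proof
  assume n: "nr x = 0"
  show "x = qzero"
  proof (rule ccontr)
    assume "x \<noteq> qzero"
    then obtain y where "qm x y = qone" using division unfolding quat_division_def by blast
    then have "nr x * nr y = 1" by (metis nrd_qmul nrd_qone)
    then show False using n by simp
  qed
qed simp

text \<open>The valuation of the norm is not halved, so multiplication by \<open>\<pi>\<close>
  raises the index by 2.\<close>

definition W :: "int \<Rightarrow> 'a quat set" where
  "W N = {x. nr x \<in> P N}"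

lemma W_iff: "x \<in> W N \<longleftrightarrow> nr x \<in> P N" by (simp add: W_def)

lemma W_qmul: "x \<in> W M \<Longrightarrow> y \<in> W N \<Longrightarrow> qm x y \<in> W (M + N)"
  by (simp add: W_iff nrd_qmul P_mult)

lemma W_qscale: "c \<in> P k \<Longrightarrow> x \<in> W N \<Longrightarrow> qscale c x \<in> W (2 * k + N)"
  by (simp add: W_iff nrd_qscale P_mult P_sq)

lemma W_qscale0: "c \<in> P 0 \<Longrightarrow> x \<in> W N \<Longrightarrow> qscale c x \<in> W N"
  using W_qscale[of c 0] by simp

lemma W_qneg: "x \<in> W N \<Longrightarrow> qneg x \<in> W N"
  by (simp add: W_iff nrd_qneg)

lemma W_qzero [simp]: "qzero \<in> W N"
  by (simp add: W_iff)

lemma W_qone [simp]: "qone \<in> W 0"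
  by (simp add: W_iff)

lemma W_mono: "x \<in> W M \<Longrightarrow> N \<le> M \<Longrightarrow> x \<in> W N"
  by (auto simp: W_iff intro: P_mono)

text \<open>If the trace were not integral, Hensel's lemma would give the minimal polynomial a root
  in the base field.\<close>

lemma trd_integral:
  assumes "x \<in> W 0"
  shows "trd x \<in> P 0"
proof (rule ccontr)
  let ?t = "trd x" let ?n = "nr x"
  assume t: "?t \<notin> P 0"
  then have t0: "?t \<noteq> 0" "v ?t < 0" by (auto simp: P_iff)
  have "?n / ?t\<^sup>2 \<in> P 1"
    using assms t0 by (intro P_divide[of _ 0 _ "2 * v ?t"]) (auto simp: W_iff v_power)
  \<comment> \<open>Substituting X = ts in X^2 - tX + n = 0 and dividing by t^2 gives this
    equation.\<close>
  then obtain s where s: "s \<in> P 1" "s = ?n / ?t\<^sup>2 + 1 * s\<^sup>2"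
    using contraction_fixpoint P_one by blast
  have "?t\<^sup>2 * s = ?t\<^sup>2 * (?n / ?t\<^sup>2 + 1 * s\<^sup>2)" using s(2) by simp
  also have "\<dots> = ?n + ?t\<^sup>2 * s\<^sup>2" using t0 by (simp add: algebra_simps)
  finally have e: "?t\<^sup>2 * s = ?n + ?t\<^sup>2 * s\<^sup>2" .
  have "nr (qadd x (Q (- (?t * s)) 0 0 0)) = ?n + ?t\<^sup>2 * s\<^sup>2 - ?t\<^sup>2 * s"
    unfolding nrd_qadd_scalar by (simp add: algebra_simps power2_eq_square)
  also have "\<dots> = 0" using e by simp
  finally have "qadd x (Q (- (?t * s)) 0 0 0) = qzero" by simp
  then have "trd (qadd x (Q (- (?t * s)) 0 0 0)) = 0" by (simp add: qzero_def)
  \<comment> \<open>So \<open>x\<close> is the scalar ts, and its trace 2ts must equal t.\<close>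
  then have "?t * 1 = ?t * (2 * s)" by (simp add: trd_qadd algebra_simps)
  then have "1 = 2 * s" using t0 by simp
  moreover have "2 * s \<in> P 1" using P_numeral s(1) by (rule P_mult0)
  ultimately show False by (metis one_notin_P1)
qed

lemma W_add_one: "x \<in> W 0 \<Longrightarrow> qadd x qone \<in> W 0"
  unfolding qone_def W_iff nrd_qadd_scalar using trd_integral[of x]
  by (auto simp: W_iff intro!: P_add)

text \<open>The summand of smaller valuation is factored out, x + y = x (x^-1 y + 1), which reduces
  the claim to adding 1 to an element of \<open>W 0\<close>. In the proof \<open>?q\<close> is x^-1
  y.\<close>

lemma W_qadd:
  assumes x: "x \<in> W N" and y: "y \<in> W N"
  shows "qadd x y \<in> W N"
proof -
  have *: "qadd x y \<in> W N" if x: "x \<in> W N" "x \<noteq> qzero" and y: "nr y \<in> P (v (nr x))" for x y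
  proof -
    let ?q = "qscale (1 / nr x) (qm (qconj x) y)"
    have nx: "nr x \<noteq> 0" using x by simp
    have "nr ?q = nr y / nr x"
      using nx by (simp add: nrd_qscale nrd_qmul nrd_qconj power2_eq_square)
    also have "\<dots> \<in> P 0" using y nx by (intro P_divide) auto
    finally have "qadd ?q qone \<in> W 0" by (intro W_add_one) (simp add: W_iff)
    then have "qm x (qadd ?q qone) \<in> W (N + 0)" by (rule W_qmul[OF x(1)])
    moreover have "qm x (qadd ?q qone) = qadd x y"
      using nx by (simp add: qmul_qadd_right qmul_qscale qmul_qconj qscale_qscale qadd_commute)
    ultimately show ?thesis by simp
  qed
  show ?thesis
  proof (cases "x = qzero \<or> y = qzero")
    case True
    then show ?thesis using x y by auto
  next
    case False
    show ?thesis
    proof (cases "v (nr x) \<le> v (nr y)")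
      case True
      then show ?thesis using False by (intro * x) (auto simp: P_iff)
    next
      case c: False
      then have "qadd y x \<in> W N" using False by (intro * y) (auto simp: P_iff)
      then show ?thesis by (simp add: qadd_commute)
    qed
  qed
qed

lemma W_qcomm: "x \<in> W 0 \<Longrightarrow> y \<in> W 0 \<Longrightarrow> qcomm a b x y \<in> W 0"
  unfolding qcomm_def using W_qmul[of x 0 y 0] W_qmul[of y 0 x 0] by (simp add: W_qadd W_qneg)

lemma W_divide_pi:
  assumes "x \<in> W 2"
  obtains y where "y \<in> W 0" "x = qscale \<pi> y"
proof
  have "1 / \<pi> \<in> P (-1)" by (rule P_divide[of _ 0 _ 1]) auto
  from W_qscale[OF this assms] show "qscale (1 / \<pi>) x \<in> W 0" by simp
  show "x = qscale \<pi> (qscale (1 / \<pi>) x)" by (simp add: qscale_qscale)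
qed

text \<open>If every integral quaternion were congruent to a scalar, the order would be
  \<open>o + o \<omega> + \<pi> W\<close> for some \<open>\<omega>\<close>; then all commutators would be infinitely divisible by \<open>\<pi>\<close>.\<close>

lemma totally_ramified_decomposition:
  assumes r: "\<And>x. x \<in> W 0 \<Longrightarrow> \<exists>r \<in> P 0. qadd x (Q (-r) 0 0 0) \<in> W 1"
  shows "\<exists>\<omega> \<in> W 0. \<forall>x \<in> W 0. \<exists>r s y. s \<in> P 0 \<and> y \<in> W 0 \<and>
    x = qadd (qadd (Q r 0 0 0) (qscale s \<omega>)) (qscale \<pi> y)"
proof (cases "\<exists>\<omega>. nr \<omega> \<noteq> 0 \<and> v (nr \<omega>) = 1")
  case True
  then obtain \<omega> where \<omega>: "nr \<omega> \<noteq> 0" "v (nr \<omega>) = 1" by blast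
  have \<omega>W: "\<omega> \<in> W 1" using \<omega> by (simp add: W_iff P_iff)
  show ?thesis
  proof (intro bexI[of _ \<omega>] ballI)
    fix x assume "x \<in> W 0"
    then obtain r where r1: "r \<in> P 0" "qadd x (Q (-r) 0 0 0) \<in> W 1" using r by blast
    define p where "p = qadd x (Q (-r) 0 0 0)"
    \<comment> \<open>This is \<open>\<omega>\<close>^-1 \<open>p\<close>. Approximating it by a
      scalar \<open>s\<close> gives \<open>p\<close> as \<open>s\<close> \<open>\<omega>\<close> up
      to an element of \<open>W 2\<close>, which is divisible by \<open>\<pi>\<close>.\<close>
    define q where "q = qscale (1 / nr \<omega>) (qm (qconj \<omega>) p)"
    have "nr q = nr p / nr \<omega>"
      using \<omega> by (simp add: q_def nrd_qscale nrd_qmul nrd_qconj power2_eq_square)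
    then have "q \<in> W 0" using r1 \<omega> by (simp add: W_iff p_def) (rule P_divide, auto)
    then obtain s where s: "s \<in> P 0" "qadd q (Q (-s) 0 0 0) \<in> W 1" using r by blast
    have "qm \<omega> (qadd q (Q (-s) 0 0 0)) \<in> W 2" using W_qmul[OF \<omega>W s(2)] by simp
    then obtain y where y: "y \<in> W 0" "qm \<omega> (qadd q (Q (-s) 0 0 0)) = qscale \<pi> y"
      by (rule W_divide_pi)
    have "p = qm \<omega> q" using \<omega> by (simp add: q_def qmul_qscale qmul_qconj qscale_qscale)
    also have "\<dots> = qadd (qscale s \<omega>) (qm \<omega> (qadd q (Q (-s) 0 0 0)))"
      by (cases \<omega>; cases q) (simp add: algebra_simps)
    finally have "p = qadd (qscale s \<omega>) (qscale \<pi> y)" unfolding y(2) .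
    moreover have "x = qadd (Q r 0 0 0) p" by (cases x) (simp add: p_def)
    ultimately show "\<exists>r s y. s \<in> P 0 \<and> y \<in> W 0 \<and>
      x = qadd (qadd (Q r 0 0 0) (qscale s \<omega>)) (qscale \<pi> y)"
      using s y by (metis qadd_assoc)
  qed (rule W_mono[OF \<omega>W], simp)
next
  case False
  \<comment> \<open>No norm has valuation 1, so \<open>W 1\<close> equals \<open>W 2\<close> and a
    scalar already approximates modulo \<open>\<pi>\<close>.\<close>
  show ?thesis
  proof (intro bexI[of _ qzero] ballI)
    fix x assume "x \<in> W 0"
    then obtain r where r1: "r \<in> P 0" "qadd x (Q (-r) 0 0 0) \<in> W 1" using r by blast
    moreover have "v (nr (qadd x (Q (-r) 0 0 0))) \<noteq> 1 \<or> nr (qadd x (Q (-r) 0 0 0)) = 0"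
      using False by blast
    ultimately have "qadd x (Q (-r) 0 0 0) \<in> W 2" unfolding W_iff P_iff by linarith
    then obtain y where y: "y \<in> W 0" "qadd x (Q (-r) 0 0 0) = qscale \<pi> y"
      by (rule W_divide_pi)
    have "x = qadd (qadd (Q r 0 0 0) (qscale 0 qzero)) (qadd x (Q (-r) 0 0 0))"
      by (cases x) (simp add: qzero_def)
    then show "\<exists>r s y. s \<in> P 0 \<and> y \<in> W 0 \<and>
      x = qadd (qadd (Q r 0 0 0) (qscale s qzero)) (qscale \<pi> y)"
      using y P_zero by metis
  qed simp
qed

text \<open>The residue of such a \<open>u\<close> lies outside the residue field of F. Without one,
  all commutators in \<open>W 0\<close> would vanish, whereas multiples of i and j do not
  commute.\<close>

lemma unramified_element_ex:
  "\<exists>u \<in> W 0. \<forall>r \<in> P 0. qadd u (Q (-r) 0 0 0) \<notin> W 1"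
proof (rule ccontr)
  assume "\<not> ?thesis"
  then have "\<exists>r \<in> P 0. qadd x (Q (-r) 0 0 0) \<in> W 1" if "x \<in> W 0" for x using that by blast
  from totally_ramified_decomposition[OF this]
  obtain \<omega> where \<omega>: "\<omega> \<in> W 0" and dec: "\<And>x. x \<in> W 0 \<Longrightarrow> \<exists>r s y. s \<in> P 0 \<and> y \<in> W 0 \<and>
      x = qadd (qadd (Q r 0 0 0) (qscale s \<omega>)) (qscale \<pi> y)" by blast
  have pi: "\<pi> \<in> P 1" "\<pi> \<in> P 0" by (simp_all add: P_iff)
  have deep: "qcomm a b x y \<in> W (2 * int N)" if "x \<in> W 0" "y \<in> W 0" for x y N
    using that
  proof (induction N arbitrary: x y)
    case 0
    then show ?case by (simp add: W_qcomm)
  next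
    case (Suc N)
    obtain r r' x' where x: "r' \<in> P 0" "x' \<in> W 0"
      "x = qadd (qadd (Q r 0 0 0) (qscale r' \<omega>)) (qscale \<pi> x')" using dec Suc.prems by blast
    obtain s s' y' where y: "s' \<in> P 0" "y' \<in> W 0"
      "y = qadd (qadd (Q s 0 0 0) (qscale s' \<omega>)) (qscale \<pi> y')" using dec Suc.prems by blast
    have "qcomm a b x y \<in> W (2 * 1 + 2 * int N)"
      unfolding x(3) y(3) qcomm_expand
      by (intro W_qscale pi W_qadd W_qscale0 Suc.IH x y \<omega>)
    then show ?case by (simp add: algebra_simps)
  qed
  \<comment> \<open>The factor \<open>c\<close> makes ci and cj integral. Their commutator is 2c^2
    k, of nonzero norm 4c^4 ab.\<close>
  obtain c where c: "c \<noteq> 0" "v c = \<bar>v a\<bar> + \<bar>v b\<bar>" using ex_val by blast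
  have "v (c\<^sup>2 * a) \<ge> 0" "v (c\<^sup>2 * b) \<ge> 0" using c ab_nz by (simp_all add: v_mult v_power)
  then have "Q 0 c 0 0 \<in> W 0" "Q 0 0 c 0 \<in> W 0"
    by (auto simp: W_iff P_iff algebra_simps power2_eq_square)
  from deep[OF this] have "nr (qcomm a b (Q 0 c 0 0) (Q 0 0 c 0)) \<in> P (int N)" for N
    using P_mono[of _ "2 * int N" "int N"] by (simp add: W_iff)
  then have "nr (qcomm a b (Q 0 c 0 0) (Q 0 0 c 0)) = 0" by (rule P_eq_zero)
  moreover have "(4::'a) \<noteq> 0" using two mult_eq_0_iff[of "2::'a" 2] by simp
  ultimately show False using c ab_nz by (simp add: qcomm_def qzero_def)
qed

end

section \<open>The unramified subfield and an orthogonal uniformizer\<close>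

definition qbasis_comb where
  "qbasis_comb a b u z r s p q =
     qadd (qadd (Q r 0 0 0) (qscale s u)) (qadd (qscale p z) (qscale q (qmul a b u z)))"

lemma nrd_qadd: "nrd a b (qadd x y) = nrd a b x + nrd a b y + trd (qmul a b x (qconj y))"
  by (cases x; cases y) (simp add: algebra_simps power2_eq_square)

text \<open>The trace conditions make F(u) and F(u)z orthogonal for the norm form, so the norms of r
  + su and (p + qu)z add up.\<close>

lemma nrd_qbasis_comb:
  assumes "trd z = 0" "trd (qmul a b u z) = 0"
  shows "nrd a b (qbasis_comb a b u z r s p q) =
    (r\<^sup>2 + trd u * r * s + nrd a b u * s\<^sup>2) + nrd a b z * (p\<^sup>2 + trd u * p * q + nrd a b u * q\<^sup>2)"
proof -
  let ?x = "qadd (Q r 0 0 0) (qscale s u)" and ?y = "qadd (Q p 0 0 0) (qscale q u)"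
  have K: "nrd a b (qadd (Q r 0 0 0) (qscale s u)) = r\<^sup>2 + trd u * r * s + nrd a b u * s\<^sup>2" for r s
    by (cases u) (simp add: algebra_simps power2_eq_square)
  have y: "qadd (qscale p z) (qscale q (qmul a b u z)) = qmul a b ?y z"
    by (cases u; cases z) (simp add: algebra_simps)
  have "trd (qmul a b ?x (qconj (qadd (qscale p z) (qscale q (qmul a b u z))))) =
    r * (p * trd z + q * trd (qmul a b u z)) + s * p * (trd u * trd z - trd (qmul a b u z)) + s * q * nrd a b u * trd z"
    by (cases u; cases z) (simp add: algebra_simps power2_eq_square)
  then have "trd (qmul a b ?x (qconj (qmul a b ?y z))) = 0" using assms y by simp
  then show ?thesis
    unfolding qbasis_comb_def nrd_qadd[of a b ?x] y by (simp add: nrd_qmul K mult.commute)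
qed

locale unramified_element = quaternion_division +
  fixes u :: "'a quat"
  assumes u_W: "u \<in> W 0" and u_unit: "\<And>r. r \<in> P 0 \<Longrightarrow> qadd u (Q (-r) 0 0 0) \<notin> W 1"
begin

text \<open>The norm form of F(u) in the basis 1, u: its value is the reduced norm of r +
  su.\<close>

definition normK :: "'a \<Rightarrow> 'a \<Rightarrow> 'a" where
  "normK r s = r\<^sup>2 + trd u * r * s + nr u * s\<^sup>2"

lemma u_int: "trd u \<in> P 0" "nr u \<in> P 0"
  using u_W trd_integral by (auto simp: W_iff)

lemma normK_integral: "r \<in> P 0 \<Longrightarrow> s \<in> P 0 \<Longrightarrow> normK r s \<in> P 0"
  unfolding normK_def using P_sq[of r 0] P_sq[of s 0] u_int by (auto intro!: P_add)

lemma normK_scale: "normK (c * r) (c * s) = c\<^sup>2 * normK r s"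
  by (simp add: normK_def algebra_simps power2_eq_square)

text \<open>The form is anisotropic over the residue field: if \<open>s\<close> is a unit, a zero
  would make \<open>u\<close> congruent to the scalar -r/s, and if \<open>s\<close> lies in p, the
  form reduces to r^2.\<close>

lemma normK_unit:
  assumes "r \<in> P 0" "s \<in> P 0" "\<not> (r \<in> P 1 \<and> s \<in> P 1)"
  shows "normK r s \<notin> P 1"
proof (cases "s \<in> P 1")
  case False
  then have s: "s \<noteq> 0" "v s = 0" using assms by (auto simp: P_iff)
  have "r / s \<in> P 0" using assms False by (intro unit_divide)
  then have "qadd u (Q (- (- (r / s))) 0 0 0) \<notin> W 1" by (intro u_unit P_minus)
  then have 1: "normK (r / s) 1 \<notin> P 1" by (simp add: W_iff nrd_qadd_scalar normK_def)
  have 2: "normK r s = s\<^sup>2 * normK (r / s) 1" using normK_scale[of s "r / s" 1] s by simp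
  have "s\<^sup>2 \<in> P 0" "s\<^sup>2 \<notin> P 1" using s v_power[of s 2] by (auto simp: P_iff)
  moreover have "normK (r / s) 1 \<in> P 0" using \<open>r / s \<in> P 0\<close> by (intro normK_integral) auto
  ultimately show ?thesis using 1 unit_mult 2 by metis
next
  case True
  show ?thesis
  proof
    assume "normK r s \<in> P 1"
    moreover have "s * (trd u * r + nr u * s) \<in> P 1"
      using assms u_int True by (intro P_mult0' P_add P_mult0)
    ultimately have "normK r s - s * (trd u * r + nr u * s) \<in> P 1" by (rule P_diff)
    then have "r\<^sup>2 \<in> P 1" by (simp add: normK_def algebra_simps power2_eq_square)
    then show False using assms True P1_sqD by blast
  qed
qed

text \<open>Dividing by the coordinate of smaller valuation leaves a primitive pair, on which the
  form is a unit. Hence norms from F(u) have even valuation, and half of it bounds both coordinates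
  from below.\<close>

lemma normK_valuation:
  assumes "r \<noteq> 0 \<or> s \<noteq> 0"
  shows "\<exists>k. normK r s \<noteq> 0 \<and> v (normK r s) = 2 * k \<and> r \<in> P k \<and> s \<in> P k"
proof -
  have "\<exists>c. c \<noteq> 0 \<and> r \<in> P (v c) \<and> s \<in> P (v c) \<and> (r = c \<or> s = c)"
  proof (cases "r \<noteq> 0 \<and> (s = 0 \<or> v r \<le> v s)")
    case True then show ?thesis by (intro exI[of _ r]) (auto simp: P_iff)
  next
    case False then show ?thesis using assms by (intro exI[of _ s]) (auto simp: P_iff)
  qed
  then obtain c where c: "c \<noteq> 0" "r \<in> P (v c)" "s \<in> P (v c)" "r = c \<or> s = c" by blast
  have rs: "r / c \<in> P 0" "s / c \<in> P 0" using c by (auto intro: P_divide)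
  moreover have "\<not> (r / c \<in> P 1 \<and> s / c \<in> P 1)" using c(1,4) by auto
  ultimately have "normK (r / c) (s / c) \<notin> P 1" "normK (r / c) (s / c) \<in> P 0"
    using normK_unit normK_integral by blast+
  then have n: "normK (r / c) (s / c) \<noteq> 0" "v (normK (r / c) (s / c)) = 0" using unit_iff by auto
  have "normK r s = c\<^sup>2 * normK (r / c) (s / c)" using normK_scale[of c "r / c" "s / c"] c by simp
  then show ?thesis using n c by (intro exI[of _ "v c"]) (simp add: v_mult v_power)
qed

text \<open>If the discriminant vanished modulo p, the residue polynomial of \<open>u\<close> would
  have a double root: a square root of -nrd(u) in residue characteristic 2, and trd(u)/2 otherwise.
  Then \<open>u\<close> would be congruent to a scalar.\<close>

lemma disc_unit: "(trd u)\<^sup>2 - 4 * nr u \<notin> P 1"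
proof
  let ?D = "(trd u)\<^sup>2 - 4 * nr u"
  assume D: "?D \<in> P 1"
  have 20: "(2::'a) \<in> P 0" by (rule P_numeral)
  have "\<exists>r \<in> P 0. normK r 1 \<in> P 1"
  proof (cases "2 \<in> P 1")
    case True
    have "2 * (2 * nr u) \<in> P 1" by (intro P_mult0'[OF True] P_mult0 20 u_int)
    from P_add[OF D this] have "(trd u)\<^sup>2 \<in> P 1" by simp
    then have t: "trd u \<in> P 1" by (rule P1_sqD)
    obtain r where r: "r \<in> P 0" "r\<^sup>2 - (- nr u) \<in> P 1"
      using residue_char2_square[OF True P_minus[OF u_int(2)]] by blast
    have "trd u * r + (r\<^sup>2 - (- nr u)) \<in> P 1"
      by (rule P_add[OF _ r(2)], rule P_mult0'[OF t r(1)])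
    then have "normK r 1 \<in> P 1" by (simp add: normK_def algebra_simps)
    then show ?thesis using r by blast
  next
    case False
    have "(2::'a) * 2 \<in> P 0 \<and> (2::'a) * 2 \<notin> P 1" by (intro unit_mult 20 False)
    then have 4: "(4::'a) \<in> P 0" "(4::'a) \<notin> P 1" by simp_all
    define r where "r = - (trd u / 2)"
    have r: "r \<in> P 0" unfolding r_def by (intro P_minus unit_divide u_int 20 False)
    have t: "trd u = - 2 * r" using two by (simp add: r_def)
    have "4 * normK r 1 = - ?D" unfolding normK_def t by (simp add: algebra_simps power2_eq_square)
    then have "4 * normK r 1 \<in> P 1" using P_minus[OF D] by simp
    moreover have "normK r 1 \<in> P 0" using r by (intro normK_integral) auto
    ultimately show ?thesis using unit_mult[OF 4, of "normK r 1"] r by blast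
  qed
  then obtain r where r: "r \<in> P 0" "normK r 1 \<in> P 1" by blast
  have "qadd u (Q (- (- r)) 0 0 0) \<notin> W 1" by (intro u_unit P_minus r)
  then show False using r by (simp add: W_iff nrd_qadd_scalar normK_def)
qed

text \<open>Every commutator hu - uh satisfies both trace conditions. If all of them vanished,
  commuting with i and j would make \<open>u\<close> a scalar, contrary to
  \<open>u_unit\<close>.\<close>

lemma orthogonal_ex: "\<exists>z. z \<noteq> qzero \<and> trd z = 0 \<and> trd (qm u z) = 0"
proof -
  obtain x0 x1 x2 x3 where u: "u = Q x0 x1 x2 x3" by (cases u)
  have orth: "trd (qcomm a b h u) = 0 \<and> trd (qm u (qcomm a b h u)) = 0" for h
    by (cases h) (simp add: qcomm_def u algebra_simps)
  have "\<exists>h. qcomm a b h u \<noteq> qzero"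
  proof (rule ccontr)
    assume *: "\<not> ?thesis"
    have i: "qcomm a b (Q 0 1 0 0) u = qzero" and j: "qcomm a b (Q 0 0 1 0) u = qzero"
      using * by auto
    have "2 * x2 = 0" "2 * x1 = 0" "a * (2 * x3) = 0"
      using i j by (simp_all add: u qcomm_def qzero_def algebra_simps)
    then have x: "x1 = 0" "x2 = 0" "x3 = 0" using ab_nz two by simp_all
    have "x0\<^sup>2 \<in> P 0" using u_W by (simp add: W_iff u x)
    then have "x0 \<in> P 0" using v_power[of x0 2] by (cases "x0 = 0") (auto simp: P_iff)
    from u_unit[OF this] show False by (simp add: u x W_iff)
  qed
  then show ?thesis using orth by blast
qed

text \<open>Otherwise \<open>z\<close> could be rescaled to have unit norm, and then \<open>- nrd z\<close> would be the norm of
  some \<open>x\<close> in the unramified quadratic subfield, so \<open>x + z\<close> would have norm zero.\<close>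

lemma orthogonal_odd:
  assumes z: "z \<noteq> qzero" "trd z = 0" "trd (qm u z) = 0"
  shows "odd (v (nr z))"
proof
  assume "even (v (nr z))"
  then obtain k where k: "v (nr z) = 2 * k" by blast
  obtain c where c: "c \<noteq> 0" "v c = - k" using ex_val by blast
  have nz: "nr z \<noteq> 0" using z by simp
  define m where "m = c\<^sup>2 * nr z"
  have m: "m \<noteq> 0" "v m = 0" using c nz k by (simp_all add: m_def v_mult v_power)
  then have "- m \<in> P 0" "- m \<notin> P 1" by (auto simp: P_iff)
  from unramified_norm_represents_unit[OF u_int disc_unit this]
  obtain r s where rs: "normK r s = - m" unfolding normK_def by blast
  have nrd: "nr (qbasis_comb a b u z r s p 0) = normK r s + nr z * p\<^sup>2" for p
    using nrd_qbasis_comb[OF z(2,3), of r s p 0] by (simp add: normK_def)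
  have "nr (qbasis_comb a b u z r s c 0) = 0" using rs by (simp add: nrd m_def)
  then have "qbasis_comb a b u z r s c 0 = qzero" by simp
  \<comment> \<open>Norm zero forces r + su = -cz, and comparing norms gives -m = m.\<close>
  then have "qbasis_comb a b u z r s 0 0 = qscale (- c) z"
    by (cases u; cases z) (auto simp: qbasis_comb_def qzero_def add_eq_0_iff2 add_eq_0_iff)
  then have "normK r s = m" using nrd[of 0] by (simp add: nrd_qscale m_def)
  then have "m + m = 0" using rs by (metis add.right_inverse)
  then have "2 * m = 0" by (simp only: mult_2)
  then have "m = 0" using two by (metis mult_eq_0_iff)
  then show False using m(1) by simp
qed

lemma uniformizer_orthogonal_ex: "\<exists>z. trd z = 0 \<and> trd (qm u z) = 0 \<and> z \<noteq> qzero \<and> v (nr z) = 1"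
proof -
  obtain z where z: "z \<noteq> qzero" "trd z = 0" "trd (qm u z) = 0" using orthogonal_ex by blast
  from orthogonal_odd[OF this] obtain k where k: "v (nr z) = 2 * k + 1" by (rule oddE)
  obtain c where c: "c \<noteq> 0" "v c = - k" using ex_val by blast
  have nz: "nr z \<noteq> 0" using z by simp
  have "nr (qscale c z) \<noteq> 0" unfolding nrd_qscale using c nz by simp
  then have "qscale c z \<noteq> qzero" by auto
  then show ?thesis using z c nz k
    by (intro exI[of _ "qscale c z"]) (auto simp: trd_qscale qmul_qscale nrd_qscale v_mult v_power)
qed

end

section \<open>An integral basis and its discriminant\<close>

lemma det_4:
  "det (A::'a::comm_ring_1^4^4) =
    A$1$1 * (A$2$2 * A$3$3 * A$4$4 + A$2$3 * A$3$4 * A$4$2 + A$2$4 * A$3$2 * A$4$3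
      - A$2$2 * A$3$4 * A$4$3 - A$2$3 * A$3$2 * A$4$4 - A$2$4 * A$3$3 * A$4$2)
  - A$1$2 * (A$2$1 * A$3$3 * A$4$4 + A$2$3 * A$3$4 * A$4$1 + A$2$4 * A$3$1 * A$4$3
      - A$2$1 * A$3$4 * A$4$3 - A$2$3 * A$3$1 * A$4$4 - A$2$4 * A$3$3 * A$4$1)
  + A$1$3 * (A$2$1 * A$3$2 * A$4$4 + A$2$2 * A$3$4 * A$4$1 + A$2$4 * A$3$1 * A$4$2
      - A$2$1 * A$3$4 * A$4$2 - A$2$2 * A$3$1 * A$4$4 - A$2$4 * A$3$2 * A$4$1)
  - A$1$4 * (A$2$1 * A$3$2 * A$4$3 + A$2$2 * A$3$3 * A$4$1 + A$2$3 * A$3$1 * A$4$2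
      - A$2$1 * A$3$3 * A$4$2 - A$2$2 * A$3$1 * A$4$3 - A$2$3 * A$3$2 * A$4$1)"
proof -
  have f1: "finite {2::4, 3, 4}" "1 \<notin> {2::4, 3, 4}" by auto
  have f2: "finite {3::4, 4}" "2 \<notin> {3::4, 4}" by auto
  have f3: "finite {4::4}" "3 \<notin> {4::4}" by auto
  show ?thesis
    unfolding det_def UNIV_4
    unfolding sum_over_permutations_insert[OF f1]
    unfolding sum_over_permutations_insert[OF f2]
    unfolding sum_over_permutations_insert[OF f3]
    unfolding permutes_sing
    by (simp add: sign_swap_id permutation_swap_id permutation_compose sign_compose sign_id
        swap_id_eq algebra_simps)
qed

section \<open>Gram matrices of the trace form\<close>

fun qvec :: "'a::field quat \<Rightarrow> 'a^4" where
  "qvec (Q x0 x1 x2 x3) = (\<chi> i. if i = 1 then x0 else if i = 2 then x1 else if i = 3 then x2 else x3)"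

lemma qvec_inject: "qvec x = qvec y \<longleftrightarrow> x = y"
  by (cases x; cases y) (auto simp: vec_eq_iff forall_4)

definition qvec_matrix :: "(4 \<Rightarrow> 'a::field quat) \<Rightarrow> 'a^4^4" where
  "qvec_matrix x = (\<chi> i. qvec (x i))"

text \<open>The basis 1, i, j, k is orthogonal for the trace form; the diagonal holds the traces of
  the squares 1, a, b, -ab.\<close>

definition trace_form_matrix :: "'a::field \<Rightarrow> 'a \<Rightarrow> 'a^4^4" where
  "trace_form_matrix a b = (\<chi> i j. if i = j then
     (if i = 1 then 2 else if i = 2 then 2 * a else if i = 3 then 2 * b else - 2 * a * b) else 0)"

definition gram :: "'a::field \<Rightarrow> 'a \<Rightarrow> (4 \<Rightarrow> 'a quat) \<Rightarrow> 'a^4^4" where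
  "gram a b x = (\<chi> i j. trd (qmul a b (x i) (x j)))"

lemma gram_eq: "gram a b x = qvec_matrix x ** (trace_form_matrix a b ** transpose (qvec_matrix x))"
proof -
  have "trd (qmul a b p q) = (\<Sum>k\<in>UNIV. qvec p $ k * (\<Sum>l\<in>UNIV. trace_form_matrix a b $ k $ l * qvec q $ l))"
    for p q
    by (cases p; cases q) (simp add: sum_4 trace_form_matrix_def algebra_simps)
  then show ?thesis
    by (simp add: gram_def matrix_matrix_mult_def qvec_matrix_def transpose_def)
qed

lemma det_gram_transform:
  assumes "qvec_matrix x = A ** qvec_matrix y"
  shows "det (gram a b x) = (det A)\<^sup>2 * det (gram a b y)"
  unfolding gram_eq assms by (simp add: det_mul power2_eq_square algebra_simps)

text \<open>The determinant of the coordinate matrix divides that of the Gram matrix, so the former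
  matrix is invertible.\<close>

lemma spans_if_det_gram_nz:
  assumes "det (gram a b y) \<noteq> 0"
  shows "\<exists>c. qvec h = c v* qvec_matrix y"
proof -
  have "det (qvec_matrix y) \<noteq> 0" using assms unfolding gram_eq by (auto simp: det_mul)
  then obtain B where "B ** qvec_matrix y = mat 1"
    using invertible_det_nz[of "qvec_matrix y"] unfolding invertible_def by blast
  then have "qvec h = (qvec h v* B) v* qvec_matrix y" by (simp add: vector_matrix_mul_assoc)
  then show ?thesis by blast
qed

definition qbasis :: "'a::field \<Rightarrow> 'a \<Rightarrow> 'a quat \<Rightarrow> 'a quat \<Rightarrow> 4 \<Rightarrow> 'a quat" where
  "qbasis a b u z i = (if i = 1 then qone else if i = 2 then u else if i = 3 then z else qmul a b u z)"

lemma qvec_qbasis_comb: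
  "qvec (qbasis_comb a b u z (c $ 1) (c $ 2) (c $ 3) (c $ 4)) = c v* qvec_matrix (qbasis a b u z)"
  by (cases u; cases z)
    (simp add: vec_eq_iff forall_4 vector_matrix_mult_def sum_4 qvec_matrix_def qbasis_def
      qbasis_comb_def qone_def algebra_simps)

text \<open>The Gram matrix is block diagonal along F(u) + F(u)z. With D = trd(u)^2 - 4 nrd(u), the
  blocks have determinants D and -nrd(z)^2 D.\<close>

lemma det_gram_qbasis:
  assumes "trd z = 0" "trd (qmul a b u z) = 0"
  shows "det (gram a b (qbasis a b u z)) = - ((nrd a b z)\<^sup>2 * ((trd u)\<^sup>2 - 4 * nrd a b u)\<^sup>2)"
proof -
  let ?t = "trd u" and ?n = "nrd a b u" and ?m = "nrd a b z"
  have 1: "trd (qone :: 'a quat) = 2" by (simp add: qone_def)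
  have zu: "trd (qmul a b z u) = 0" using assms trd_qmul_commute by metis
  have uuz: "trd (qmul a b u (qmul a b u z)) = 0" "trd (qmul a b (qmul a b u z) u) = 0"
    using assms trd_qmul_qmul trd_qmul_commute[of a b "qmul a b u z" u] by (simp_all add: trd_qmul_qmul)
  have zuz: "trd (qmul a b z (qmul a b u z)) = - ?m * ?t" "trd (qmul a b (qmul a b u z) z) = - ?m * ?t"
  proof -
    have "trd (qmul a b (qmul a b u z) z) = trd (qmul a b z (qmul a b z u))"
      unfolding qmul_assoc[of a b z z u, symmetric] trd_qmul_commute[of a b "qmul a b z z"] by (simp add: qmul_assoc)
    then show "trd (qmul a b (qmul a b u z) z) = - ?m * ?t" using assms by (simp add: trd_qmul_qmul)
    then show "trd (qmul a b z (qmul a b u z)) = - ?m * ?t" by (simp add: trd_qmul_commute)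
  qed
  show ?thesis
    unfolding det_4 using assms zu uuz zuz 1
    by (simp add: gram_def qbasis_def trd_qmul_self nrd_qmul) (simp add: algebra_simps power2_eq_square)
qed

section \<open>Integral coordinates with respect to 1, u, z, uz\<close>

locale unramified_basis = unramified_element +
  fixes z :: "'a quat"
  assumes z_orth: "trd z = 0" "trd (qm u z) = 0" and z_nz: "z \<noteq> qzero" and v_z: "v (nr z) = 1"
begin

abbreviation "comb \<equiv> qbasis_comb a b u z"
abbreviation "disc_generator \<equiv> det (gram a b (qbasis a b u z))"

lemma nr_z_nz: "nr z \<noteq> 0"
  using z_nz by simp

lemma disc_generator: "disc_generator \<noteq> 0" "v disc_generator = 2"
proof -
  let ?D = "(trd u)\<^sup>2 - 4 * nr u"
  have "?D \<in> P 0"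
    using P_sq[of "trd u" 0] u_int P_numeral by (auto intro!: P_diff)
  then have D: "?D \<noteq> 0" "v ?D = 0" using disc_unit unit_iff by blast+
  have "disc_generator = - ((nr z)\<^sup>2 * ?D\<^sup>2)" by (rule det_gram_qbasis[OF z_orth])
  then show "disc_generator \<noteq> 0" "v disc_generator = 2"
    using D nr_z_nz v_z by (simp_all add: v_mult v_power)
qed

lemma comb_ex: "\<exists>c :: 'a^4. h = comb (c $ 1) (c $ 2) (c $ 3) (c $ 4)"
  using spans_if_det_gram_nz[OF disc_generator(1), of h]
  unfolding qvec_qbasis_comb[symmetric] qvec_inject .

lemma nr_comb: "nr (comb r s p q) = normK r s + nr z * normK p q"
  unfolding normK_def by (rule nrd_qbasis_comb[OF z_orth])

text \<open>The two summands of the norm have even and odd valuation, so they cannot cancel. If the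
  sum is integral, both are, and \<open>normK_valuation\<close> bounds the coordinates.\<close>

lemma comb_W_iff: "comb r s p q \<in> W 0 \<longleftrightarrow> r \<in> P 0 \<and> s \<in> P 0 \<and> p \<in> P 0 \<and> q \<in> P 0"
proof
  have zP: "nr z \<in> P 0" using v_z by (simp add: P_iff)
  assume "r \<in> P 0 \<and> s \<in> P 0 \<and> p \<in> P 0 \<and> q \<in> P 0"
  then show "comb r s p q \<in> W 0"
    unfolding W_iff nr_comb using zP by (auto intro!: P_add normK_integral)
next
  let ?A = "normK r s" and ?B = "nr z * normK p q"
  assume "comb r s p q \<in> W 0"
  then have sum: "?A + ?B \<in> P 0" by (simp add: W_iff nr_comb)
  have A: "?A = 0 \<or> even (v ?A)"
    using normK_valuation[of r s] by (cases "r = 0 \<and> s = 0") (auto simp: normK_def)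
  have "normK p q = 0 \<or> even (v (normK p q))"
    using normK_valuation[of p q] by (cases "p = 0 \<and> q = 0") (auto simp: normK_def)
  then have B: "?B = 0 \<or> odd (v ?B)" using nr_z_nz v_z v_mult[of "nr z" "normK p q"] by auto
  have AP: "?A \<in> P 0" using A B by (intro P_addD[OF sum]) metis
  have BP: "?B \<in> P 0" using P_diff[OF sum AP] by simp
  have rs: "r \<in> P 0 \<and> s \<in> P 0"
  proof (cases "r = 0 \<and> s = 0")
    case False
    then obtain k where k: "?A \<noteq> 0" "v ?A = 2 * k" "r \<in> P k" "s \<in> P k"
      using normK_valuation by blast
    then have "k \<ge> 0" using AP by (simp add: P_iff)
    then show ?thesis using k P_mono by blast
  qed simp
  have pq: "p \<in> P 0 \<and> q \<in> P 0"
  proof (cases "p = 0 \<and> q = 0")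
    case False
    then obtain k where k: "normK p q \<noteq> 0" "v (normK p q) = 2 * k" "p \<in> P k" "q \<in> P k"
      using normK_valuation by blast
    \<comment> \<open>The uniformizer \<open>nr z\<close> costs only 1, and an integer
      \<open>k\<close> with 1 + 2k nonnegative is itself nonnegative.\<close>
    then have "1 + 2 * k \<ge> 0" using BP nr_z_nz v_z v_mult[of "nr z" "normK p q"] by (simp add: P_iff)
    then have "k \<ge> 0" by simp
    then show ?thesis using k P_mono by blast
  qed simp
  show "r \<in> P 0 \<and> s \<in> P 0 \<and> p \<in> P 0 \<and> q \<in> P 0" using rs pq by blast
qed

lemma lincomb_basis: "lincomb [r, s, p, q] [qone, u, z, qm u z] = comb r s p q"
  by (cases u; cases z) (simp add: lincomb_def qbasis_comb_def qzero_def qone_def algebra_simps)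

lemma W_lattice: "o_lattice v (W 0)"
  unfolding o_lattice_def
proof (intro exI[of _ "[qone, u, z, qm u z]"] conjI allI)
  let ?gs = "[qone, u, z, qm u z]"
  show "W 0 = {lincomb cs ?gs | cs. length cs = length ?gs \<and> set cs \<subseteq> oring v}"
  proof (intro subset_antisym subsetI)
    fix h assume h: "h \<in> W 0"
    obtain c :: "'a^4" where c: "h = comb (c $ 1) (c $ 2) (c $ 3) (c $ 4)" using comb_ex by blast
    with h have "set [c $ 1, c $ 2, c $ 3, c $ 4] \<subseteq> oring v" by (simp add: comb_W_iff oring_eq)
    then show "h \<in> {lincomb cs ?gs | cs. length cs = length ?gs \<and> set cs \<subseteq> oring v}"
      using c by (intro CollectI exI[of _ "[c $ 1, c $ 2, c $ 3, c $ 4]"]) (simp add: lincomb_basis)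
  next
    fix h assume "h \<in> {lincomb cs ?gs | cs. length cs = length ?gs \<and> set cs \<subseteq> oring v}"
    then obtain cs where cs: "h = lincomb cs ?gs" "length cs = 4" "set cs \<subseteq> P 0"
      by (auto simp: oring_eq)
    then obtain r s p q where "cs = [r, s, p, q]" by (auto simp: length_Suc_conv numeral_eq_Suc)
    then show "h \<in> W 0" using cs by (simp add: lincomb_basis comb_W_iff)
  qed
  fix h
  obtain c :: "'a^4" where "h = comb (c $ 1) (c $ 2) (c $ 3) (c $ 4)" using comb_ex by blast
  then show "\<exists>ds. length ds = length ?gs \<and> h = lincomb ds ?gs"
    by (intro exI[of _ "[c $ 1, c $ 2, c $ 3, c $ 4]"]) (simp add: lincomb_basis)
qed

lemma det_integral: "(\<And>i j. A $ i $ j \<in> P 0) \<Longrightarrow> det (A :: 'a^4^4) \<in> P 0"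
  unfolding det_4 by (intro P_add P_diff P_mult0)

text \<open>The coordinate matrix \<open>A\<close> is integral, and the change of basis multiplies
  \<open>disc_generator\<close>, of valuation 2, by \<open>(det A)\<^sup>2\<close>.\<close>

lemma det_gram_W:
  assumes "\<And>i. x i \<in> W 0"
  shows "det (gram a b x) \<in> P 2"
proof -
  have "\<exists>c :: 4 \<Rightarrow> 'a^4. \<forall>i. x i = comb (c i $ 1) (c i $ 2) (c i $ 3) (c i $ 4)"
    using comb_ex by (intro choice) blast
  then obtain c :: "4 \<Rightarrow> 'a^4"
    where c: "\<And>i. x i = comb (c i $ 1) (c i $ 2) (c i $ 3) (c i $ 4)" by blast
  define A where "A = (\<chi> i. c i)"
  have "A $ i $ j \<in> P 0" for i j
    using assms[of i] exhaust_4[of j] unfolding c[of i] comb_W_iff by (auto simp: A_def)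
  then have A: "(det A)\<^sup>2 \<in> P 0" using det_integral P_sq[of "det A" 0] by simp
  have "qvec_matrix x = A ** qvec_matrix (qbasis a b u z)"
    unfolding vec_eq_iff[of "qvec_matrix x"]
  proof
    fix i
    have "qvec_matrix x $ i = c i v* qvec_matrix (qbasis a b u z)"
      using qvec_qbasis_comb[of a b u z "c i"] c[of i] by (simp add: qvec_matrix_def)
    then show "qvec_matrix x $ i = (A ** qvec_matrix (qbasis a b u z)) $ i"
      by (simp add: vec_eq_iff vector_matrix_mult_def matrix_matrix_mult_def A_def)
  qed
  from det_gram_transform[OF this] show ?thesis
    using A disc_generator by (auto simp: P_iff[of disc_generator] intro!: P_mult0)
qed

lemma qbasis_W: "qbasis a b u z i \<in> W 0"
proof -
  have z: "z \<in> W 0" using v_z by (simp add: W_iff P_iff)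
  then show ?thesis using u_W W_qmul[of u 0 z 0] by (simp add: qbasis_def)
qed

end

section \<open>Orders, involutions and the reduced discriminant\<close>

lemma lincomb_Nil [simp]: "lincomb [] [] = qzero"
  and lincomb_Cons [simp]: "lincomb (c # cs) (g # gs) = qadd (qscale c g) (lincomb cs gs)"
  by (simp_all add: lincomb_def)

section \<open>Products and square roots of ideals\<close>

context local_field
begin

text \<open>An element of minimal valuation generates the whole ideal.\<close>

lemma o_ideal_gen_eq_P:
  assumes S: "S \<subseteq> P N" and x: "x \<in> S" "x \<noteq> 0" "v x = N"
  shows "o_ideal_gen v S = P N"
proof (intro subset_antisym subsetI)
  fix y assume "y \<in> o_ideal_gen v S"
  then obtain cs ss where y: "y = sum_list (map2 (*) cs ss)" "length cs = length ss"
    "set cs \<subseteq> P 0" "set ss \<subseteq> S" unfolding o_ideal_gen_def oring_eq by blast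
  from y(2-4) have "sum_list (map2 (*) cs ss) \<in> P N"
    by (induction cs ss rule: list_induct2) (use S in \<open>auto intro!: P_add\<close>)
  then show "y \<in> P N" using y(1) by simp
next
  fix y assume "y \<in> P N"
  then have "y / x \<in> P 0" using x by (intro P_divide) auto
  then show "y \<in> o_ideal_gen v S"
    unfolding o_ideal_gen_def oring_eq using x
    by (intro CollectI exI[of _ "[y / x]"] exI[of _ "[x]"]) simp
qed

lemma ideal_prod_P: "ideal_prod v (P M) (P N) = P (M + N)"
proof -
  obtain c d where "c \<noteq> 0" "v c = M" "d \<noteq> 0" "v d = N" using ex_val by metis
  then have cd: "c \<in> P M" "d \<in> P N" "c * d \<noteq> 0" "v (c * d) = M + N"
    by (simp_all add: P_iff v_mult)
  have "{x * y | x y. x \<in> P M \<and> y \<in> P N} \<subseteq> P (M + N)" using P_mult by blast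
  moreover have "c * d \<in> {x * y | x y. x \<in> P M \<and> y \<in> P N}" using cd by blast
  ultimately show ?thesis unfolding ideal_prod_def using cd(3,4) by (rule o_ideal_gen_eq_P)
qed

lemma o_ideal_P1: "o_ideal v (P 1)"
  unfolding o_ideal_def oring_eq by (auto intro: P_add P_mono)

text \<open>This is the uniqueness behind the definite description in \<open>order_disc\<close>.
  Squares of elements force \<open>I\<close> into p; if \<open>I\<close> lay in p^2, its square
  would lie in p^4. So \<open>I\<close> contains an element of valuation 1, which generates
  p.\<close>

lemma ideal_sqrt_P2:
  assumes I: "o_ideal v I" and sq: "ideal_prod v I I = P 2"
  shows "I = P 1"
proof -
  have mem: "x * y \<in> P 2" if "x \<in> I" "y \<in> I" for x y
  proof -
    have "x * y \<in> ideal_prod v I I" unfolding ideal_prod_def o_ideal_gen_def oring_eq using that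
      by (intro CollectI exI[of _ "[1]"] exI[of _ "[x * y]"]) auto
    then show ?thesis using sq by simp
  qed
  have sub: "I \<subseteq> P 1"
  proof
    fix x assume x: "x \<in> I"
    then have "x \<in> P 0" using I by (auto simp: o_ideal_def oring_eq)
    then show "x \<in> P 1" using mem[OF x x] v_mult[of x x] by (cases "x = 0") (auto simp: P_iff)
  qed
  have "\<not> I \<subseteq> P 2"
  proof
    assume "I \<subseteq> P 2"
    have "y \<in> P 4" if y: "y \<in> ideal_prod v I I" for y
    proof -
      have "ideal_prod v I I \<subseteq> ideal_prod v (P 2) (P 2)"
        using \<open>I \<subseteq> P 2\<close> unfolding ideal_prod_def o_ideal_gen_def by blast
      then show ?thesis using y ideal_prod_P[of 2 2] by auto
    qed
    moreover have "\<pi> * \<pi> \<in> P 2" by (simp add: P_iff v_mult)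
    ultimately have "\<pi> * \<pi> \<in> P 4" using sq by simp
    then show False by (simp add: P_iff v_mult)
  qed
  then obtain x where x: "x \<in> I" "x \<notin> P 2" by blast
  then have x1: "x \<noteq> 0" "v x = 1" using sub by (auto simp: P_iff)
  have "P 1 \<subseteq> I"
  proof
    fix y assume "y \<in> P 1"
    then have "y / x \<in> oring v" unfolding oring_eq using x1 by (intro P_divide) auto
    then have "y / x * x \<in> I" using I x(1) unfolding o_ideal_def by blast
    then show "y \<in> I" using x1 by simp
  qed
  then show ?thesis using sub by blast
qed

end

section \<open>Orders compared with the valuation ring\<close>

context quaternion_division
begin

lemma lincomb_bounded:
  "\<exists>N. \<forall>cs. length cs = length gs \<longrightarrow> set cs \<subseteq> P 0 \<longrightarrow> lincomb cs gs \<in> W N"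
proof (induction gs)
  case (Cons g gs)
  then obtain N where N: "\<And>cs. length cs = length gs \<Longrightarrow> set cs \<subseteq> P 0 \<Longrightarrow> lincomb cs gs \<in> W N"
    by blast
  \<comment> \<open>If \<open>g\<close> is zero, \<open>v (nr g)\<close> is arbitrary, but zero lies
    in every \<open>W N\<close>.\<close>
  let ?M = "min N (v (nr g))"
  have "lincomb cs (g # gs) \<in> W ?M" if len: "length cs = length (g # gs)" "set cs \<subseteq> P 0" for cs
  proof -
    obtain c cs' where cs: "cs = c # cs'" using len(1) by (auto simp: length_Suc_conv)
    have "qscale c g \<in> W ?M" using that cs by (intro W_qscale0) (auto simp: W_iff P_iff)
    moreover have "lincomb cs' gs \<in> W ?M" using that cs by (intro W_mono[OF N]) auto
    ultimately show ?thesis unfolding cs lincomb_Cons by (rule W_qadd)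
  qed
  then show ?case by blast
qed simp

lemma order_subset_W:
  assumes ord: "is_order v a b R"
  shows "R \<subseteq> W 0"
proof
  fix x assume x: "x \<in> R"
  have one: "qone \<in> R" and mult: "\<And>x y. x \<in> R \<Longrightarrow> y \<in> R \<Longrightarrow> qm x y \<in> R"
    using ord by (auto simp: is_order_def)
  obtain gs where gs: "R = {lincomb cs gs | cs. length cs = length gs \<and> set cs \<subseteq> P 0}"
    using ord unfolding is_order_def o_lattice_def oring_eq by blast
  obtain N where N: "\<And>cs. length cs = length gs \<Longrightarrow> set cs \<subseteq> P 0 \<Longrightarrow> lincomb cs gs \<in> W N"
    using lincomb_bounded[of gs] by blast
  have pow: "(qm x ^^ n) qone \<in> R \<and> nr ((qm x ^^ n) qone) = nr x ^ n" for n
    by (induction n) (auto simp: one x mult nrd_qmul)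
  show "x \<in> W 0"
  proof (rule ccontr)
    assume "x \<notin> W 0"
    then have v: "nr x \<noteq> 0" "v (nr x) \<le> -1" by (simp_all add: W_iff P_iff)
    \<comment> \<open>Large enough that -n < N, so the norm of the n-th power violates the bound
      \<open>N\<close>.\<close>
    define n where "n = nat (- N) + 1"
    have "(qm x ^^ n) qone \<in> W N" using pow[of n] gs N by auto
    then have "nr x ^ n \<in> P N" using pow[of n] by (simp add: W_iff)
    then have "N \<le> int n * v (nr x)" using v(1) by (simp add: P_iff v_power)
    also have "\<dots> \<le> int n * (-1)" using v(2) by (intro mult_left_mono) auto
    also have "\<dots> < N" by (simp add: n_def)
    finally show False by simp
  qed
qed

text \<open>Applied to \<open>W 0\<close>, this makes its image an order, which therefore lies in
  \<open>W 0\<close>; stability follows without computing norms of images.\<close>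

lemma involution_image_order:
  assumes inv: "involution a b \<sigma>" and ord: "is_order v a b R"
  shows "is_order v a b (\<sigma> ` R)"
proof -
  have add: "\<sigma> (qadd x y) = qadd (\<sigma> x) (\<sigma> y)" and scale: "\<sigma> (qscale c x) = qscale c (\<sigma> x)"
    and mult: "\<sigma> (qm x y) = qm (\<sigma> y) (\<sigma> x)" and inv: "\<sigma> (\<sigma> x) = x" for c x y
    using inv by (auto simp: involution_def)
  have zero: "\<sigma> qzero = qzero" using scale[of 0 qzero] by simp
  \<comment> \<open>Applying \<open>\<sigma>\<close> to the product of 1 and
    \<open>\<sigma> qone\<close> gives \<open>qone\<close> on the left and
    \<open>\<sigma> qone\<close> on the right.\<close>
  have one: "\<sigma> qone = qone"
    using mult[of qone "\<sigma> qone"] inv[of qone] by simp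
  have lin: "\<sigma> (lincomb cs gs) = lincomb cs (map \<sigma> gs)" if "length cs = length gs" for cs gs
    using that by (induction cs gs rule: list_induct2) (simp_all add: zero add scale)
  obtain gs where gs: "R = {lincomb cs gs | cs. length cs = length gs \<and> set cs \<subseteq> oring v}"
    and span: "\<And>h. \<exists>ds. length ds = length gs \<and> h = lincomb ds gs"
    using ord unfolding is_order_def o_lattice_def by blast
  have "o_lattice v (\<sigma> ` R)"
    unfolding o_lattice_def
  proof (intro exI[of _ "map \<sigma> gs"] conjI allI)
    show "\<sigma> ` R = {lincomb cs (map \<sigma> gs) | cs. length cs = length (map \<sigma> gs) \<and> set cs \<subseteq> oring v}"
      unfolding gs by (force simp: lin)
    fix h
    obtain ds where "length ds = length gs" "\<sigma> h = lincomb ds gs" using span by blast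
    then show "\<exists>ds. length ds = length (map \<sigma> gs) \<and> h = lincomb ds (map \<sigma> gs)"
      using inv[of h] lin by (metis length_map)
  qed
  moreover have "qone \<in> \<sigma> ` R" using ord one by (auto simp: is_order_def intro: rev_image_eqI)
  moreover have "\<forall>x\<in>\<sigma> ` R. \<forall>y\<in>\<sigma> ` R. qm x y \<in> \<sigma> ` R"
    using ord mult[symmetric] by (auto simp: is_order_def)
  ultimately show ?thesis by (simp add: is_order_def)
qed

lemma unramified_basis_ex: "\<exists>u z. unramified_basis v a b u z"
proof -
  obtain u where "u \<in> W 0" "\<And>r. r \<in> P 0 \<Longrightarrow> qadd u (Q (-r) 0 0 0) \<notin> W 1"
    using unramified_element_ex by blast
  then interpret unramified_element v a b u by unfold_locales
  obtain z where "trd z = 0" "trd (qm u z) = 0" "z \<noteq> qzero" "v (nr z) = 1"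
    using uniformizer_orthogonal_ex by blast
  then have "unramified_basis v a b u z" by unfold_locales
  then show ?thesis by blast
qed

lemma W_order: "is_order v a b (W 0)"
proof -
  obtain u z where "unramified_basis v a b u z" using unramified_basis_ex by blast
  then have "o_lattice v (W 0)" by (rule unramified_basis.W_lattice)
  then show ?thesis using W_qmul[of _ 0 _ 0] by (simp add: is_order_def)
qed

lemma W_max_order: "max_order v a b (W 0)"
  unfolding max_order_def using W_order order_subset_W by blast

lemma order_disc_W: "order_disc v a b (W 0) = P 1"
proof -
  obtain u z where "unramified_basis v a b u z" using unramified_basis_ex by blast
  then interpret unramified_basis v a b u z .
  have "order_disc_full v a b (W 0) = o_ideal_gen v {det (gram a b x) | x. \<forall>i. x i \<in> W 0}"
    by (simp add: order_disc_full_def gram_def)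
  also have "\<dots> = P 2"
  proof (rule o_ideal_gen_eq_P)
    show "{det (gram a b x) | x. \<forall>i. x i \<in> W 0} \<subseteq> P 2" using det_gram_W by blast
    show "disc_generator \<in> {det (gram a b x) | x. \<forall>i. x i \<in> W 0}" using qbasis_W by blast
  qed (rule disc_generator)+
  finally have full: "order_disc_full v a b (W 0) = P 2" .
  show ?thesis
    unfolding order_disc_def full
  proof (rule the_equality)
    show "o_ideal v (P 1) \<and> ideal_prod v (P 1) (P 1) = P 2"
      using o_ideal_P1 ideal_prod_P[of 1 1] by simp
  qed (simp add: ideal_sqrt_P2)
qed

text \<open>\<open>W 0\<close> is stable under \<open>\<sigma>\<close> and contains every order, so
  it is the greatest stable order and thus the only maximal one.\<close>

lemma W_max_inv_order_iff:
  assumes inv: "involution a b \<sigma>"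
  shows "max_inv_order v a b \<sigma> R \<longleftrightarrow> R = W 0"
proof -
  have sub: "\<sigma> ` W 0 \<subseteq> W 0" by (intro order_subset_W involution_image_order inv W_order)
  have "\<sigma> (\<sigma> x) = x" for x using inv by (auto simp: involution_def)
  then have "W 0 \<subseteq> \<sigma> ` W 0" using sub by (metis image_eqI image_subset_iff subsetI)
  then have "inv_order v a b \<sigma> (W 0)" using sub W_order by (auto simp: inv_order_def)
  moreover have "R \<subseteq> W 0" if "inv_order v a b \<sigma> R" for R
    using that order_subset_W by (simp add: inv_order_def)
  ultimately show ?thesis unfolding max_inv_order_def by blast
qed

end

theorem theorem4p1:
  fixes v :: "'a::field \<Rightarrow> int" and a b :: 'a and \<sigma> :: "'a quat \<Rightarrow> 'a quat"
    and Ord :: "'a quat set"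
  assumes "nonarch_local_field v"
    and "(2::'a) \<noteq> 0"
    and "quat_division a b"
    and "orth_involution a b \<sigma>"
    and "Ord = {h. nrd a b h \<in> oring v}"
  shows "(\<forall>Ord'. max_inv_order v a b \<sigma> Ord' \<longleftrightarrow> Ord' = Ord)
    \<and> max_order v a b Ord
    \<and> order_disc v a b Ord = pideal v
    \<and> pideal v = quat_disc v a b \<inter> iota_disc_inv v a b \<sigma>"
proof -
  interpret quaternion_division v a b using assms(1-3) by unfold_locales
  have Ord: "Ord = W 0" using assms(5) by (auto simp: W_iff oring_eq)
  have inv: "involution a b \<sigma>" using assms(4) by (simp add: orth_involution_def)
  \<comment> \<open>Here \<open>quat_disc\<close> is p, and \<open>iota_disc_inv\<close> is o or p
    according to parity; either contains p.\<close>
  have "pideal v = quat_disc v a b \<inter> iota_disc_inv v a b \<sigma>"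
    using division by (auto simp: quat_disc_def iota_disc_inv_def Let_def oring_def pideal_def)
  then show ?thesis
    using W_max_inv_order_iff[OF inv] W_max_order order_disc_W by (simp add: Ord pideal_eq)
qed

end
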